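(* Suppose that for every $S\in\Omega$ the function $f(\cdot;S):\mathbb{R}^n\to\mathbb{R}$ is proper, closed, convex and Lipschitz continuous with constant $L_{f,S}>0$, i.e. $|f(x;S)-f(y;S)|\le L_{f,S}\|x-y\|$ for all $x,y\in\mathbb{R}^n$, and that there exists $\kappa>0$ such that $\mathrm{dist}_X^2(x)\le\kappa\,\mathbb{E}[\mathrm{dist}_{X_S}^2(x)]$ for all $x\in\mathbb{R}^n$. Assume also $\|x^0-x^*\|\ge1$ and $\mathbb{E}[L_{f,S}^2]\ge2$. Let $\epsilon>0$, let $K$ be an integer satisfying $$K\ge\frac{\mathbb{E}[L_{f,S}^2]\,\|x^0-x^*\|^2}{\epsilon^2}\max\left\{1,(3\kappa+\sqrt{2\kappa})^2\right\},$$ and let $\{x^k\}_{k\ge0}$ be generated by algorithm SPP with constant stepsize $$\mu=\frac{\epsilon}{\mathbb{E}[L_{f,S}^2](3\kappa+\sqrt{2\kappa})}.$$ Then after $K$ iterations the average point $\hat x^K=\frac1K\sum_{i=0}^{K-1}x^i$ satisfies $$\left|\mathbb{E}[F(\hat x^K)]-F^*\right|\le\epsilon\quad\text{and}\quad\sqrt{\mathbb{E}[\mathrm{dist}_X^2(\hat x^K)]}\le\epsilon.$$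
   Context: Problem: $F^*=\min_{x\in\mathbb{R}^n}F(x):=\mathbb{E}[f(x;S)]$ subject to $x\in X:=\bigcap_{S\in\Omega}X_S$, where $S$ is a random variable with probability space $(\Omega,\mathbb{P})$, each $f(\cdot;S):\mathbb{R}^n\to\mathbb{R}$ is convex with full domain, and each $X_S\subseteq\mathbb{R}^n$ is nonempty, closed and convex. $x^*$ denotes any optimal solution. $\|\cdot\|$ is the Euclidean norm, $[\cdot]_Y$ the projection onto a closed convex set $Y$, and $\mathrm{dist}_Y(x)=\|x-[x]_Y\|$. Algorithm SPP (stochastic proximal point) with starting point $x^0\in\mathbb{R}^n$ and constant stepsize $\mu>0$: for $k=0,1,2,\dots$, draw $S_k\in\Omega$ according to $\mathbb{P}$, independently of $S_0,\dots,S_{k-1}$, and set $y^k=z_{\mu}(x^k;S_k)$, $x^{k+1}=[y^k]_{X_{S_k}}$, where $z_\mu(x;S)=\arg\min_{z\in\mathbb{R}^n}\left\{f(z;S)+\frac{1}{2\mu}\|z-x\|^2\right\}$. Expectations are over all random choices.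
   Formalization: Adds: if X is all of R^n, then 3κ+√(2κ) ≥ 1. Without it the claim is false (unconstrained, tiny κ makes the stepsize too large, e.g. f(x;S)=|x|+10Sx, S=±1, κ=10^-4, K=2). If X is a proper subset, the condition is automatic since κ ≥ 1. *)

theory Defs
  imports "HOL-Probability.Probability"
begin

definition proj_dist :: "'a::euclidean_space set \<Rightarrow> 'a \<Rightarrow> real" where
  "proj_dist Y x = norm (x - closest_point Y x)"

definition prox :: "real \<Rightarrow> ('a::euclidean_space \<Rightarrow> real) \<Rightarrow> 'a \<Rightarrow> 'a" where
  "prox \<mu> g x = arg_min (\<lambda>z. g z + 1 / (2 * \<mu>) * (norm (z - x))\<^sup>2) (\<lambda>_. True)"

definition objective ::
  "'s measure \<Rightarrow> ('s \<Rightarrow> 'a::euclidean_space \<Rightarrow> real) \<Rightarrow> 'a \<Rightarrow> real" where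
  "objective M f x = (\<integral>s. f s x \<partial>M)"

definition feasible :: "'s measure \<Rightarrow> ('s \<Rightarrow> 'a::euclidean_space set) \<Rightarrow> 'a set" where
  "feasible M X = (\<Inter>s\<in>space M. X s)"

definition opt_value ::
  "'s measure \<Rightarrow> ('s \<Rightarrow> 'a::euclidean_space \<Rightarrow> real) \<Rightarrow> ('s \<Rightarrow> 'a set) \<Rightarrow> real" where
  "opt_value M f X = (INF x\<in>feasible M X. objective M f x)"

definition optimal_solution ::
  "'s measure \<Rightarrow> ('s \<Rightarrow> 'a::euclidean_space \<Rightarrow> real) \<Rightarrow> ('s \<Rightarrow> 'a set) \<Rightarrow> 'a \<Rightarrow> bool" where
  "optimal_solution M f X x \<longleftrightarrow>
     x \<in> feasible M X \<and> (\<forall>y\<in>feasible M X. objective M f x \<le> objective M f y)"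

text \<open>The sequence \<open>s\<close> is one realization of the draws; randomness enters by
  substituting \<open>\<lambda>k. S k \<omega>\<close> for it.\<close>

primrec spp ::
  "real \<Rightarrow> ('s \<Rightarrow> 'a::euclidean_space \<Rightarrow> real) \<Rightarrow> ('s \<Rightarrow> 'a set) \<Rightarrow> 'a \<Rightarrow> (nat \<Rightarrow> 's) \<Rightarrow> nat \<Rightarrow> 'a"
where
  "spp \<mu> f X x0 s 0 = x0"
| "spp \<mu> f X x0 s (Suc k) =
     closest_point (X (s k)) (prox \<mu> (f (s k)) (spp \<mu> f X x0 s k))"

definition spp_average ::
  "real \<Rightarrow> ('s \<Rightarrow> 'a::euclidean_space \<Rightarrow> real) \<Rightarrow> ('s \<Rightarrow> 'a set) \<Rightarrow> 'a \<Rightarrow> (nat \<Rightarrow> 's) \<Rightarrow> nat \<Rightarrow> 'a"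
where
  "spp_average \<mu> f X x0 s K = (1 / real K) *\<^sub>R (\<Sum>i<K. spp \<mu> f X x0 s i)"

end

theory Submission
  imports Defs
begin

text \<open>The three-point inequality for the proximal step and the Pythagorean inequality for the
  projection give, with \<open>t\<close> the length of the proximal step and \<open>e\<close> the distance of its endpoint to
  the sampled set, a descent of \<open>\<parallel>x\<^sup>k - x\<^sup>*\<parallel>\<^sup>2\<close> with error \<open>2\<mu>Lt - t\<^sup>2 - e\<^sup>2\<close>. Bounding this error by
  \<open>(\<mu>L)\<^sup>2\<close> and averaging yields the upper bound on the objective. Bounding it by
  \<open>4(\<mu>L)\<^sup>2 - 3/4 d\<^sup>2\<close>, where \<open>d\<close> is the distance of \<open>x\<^sup>k\<close> to the sampled set, and using linear
  regularity yields the bound on the infeasibility, which in turn controls how far the objective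
  can drop below its optimal value. Unless the problem is unconstrained, linear regularity forces
  \<open>\<kappa> \<ge> 1\<close>, since the distance to a sampled set never exceeds the distance to the intersection.\<close>

subsection \<open>Projections and proximal steps\<close>

lemma proj_dist_nonneg: "0 \<le> proj_dist Y x"
  by (simp add: proj_dist_def)

lemma proj_dist_le:
  assumes "closed Y" "y \<in> Y"
  shows "proj_dist Y x \<le> norm (x - y)"
  using closest_point_le[OF assms, of x] by (simp add: proj_dist_def dist_norm)

lemma proj_dist_triangle:
  assumes "closed Y" "Y \<noteq> {}"
  shows "proj_dist Y x \<le> proj_dist Y x' + norm (x - x')"
proof -
  have "proj_dist Y x \<le> norm (x - closest_point Y x')"
    using assms by (intro proj_dist_le closest_point_in_set)
  also have "\<dots> \<le> norm (x - x') + norm (x' - closest_point Y x')"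
    using norm_triangle_ineq[of "x - x'" "x' - closest_point Y x'"] by simp
  finally show ?thesis by (simp add: proj_dist_def)
qed

lemma continuous_on_proj_dist:
  assumes "closed Y" "convex Y" "Y \<noteq> {}"
  shows "continuous_on A (proj_dist Y)"
  unfolding proj_dist_def using assms by (intro continuous_intros continuous_on_closest_point)

text \<open>The angle at the projection is not acute (\<open>closest_point_dot\<close>), so the
  cross term in the expansion of the square has the favourable sign.\<close>

lemma closest_point_pythagoras:
  assumes "closed Y" "convex Y" "z \<in> Y"
  shows "(norm (closest_point Y y - z))\<^sup>2 \<le> (norm (y - z))\<^sup>2 - (proj_dist Y y)\<^sup>2"
proof -
  let ?p = "closest_point Y y"
  have "(norm (y - z))\<^sup>2 = (norm ((y - ?p) - (z - ?p)))\<^sup>2" by simp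
  also have "\<dots> = (proj_dist Y y)\<^sup>2 + (norm (z - ?p))\<^sup>2 - 2 * inner (y - ?p) (z - ?p)"
    unfolding proj_dist_def power2_norm_eq_inner
    by (simp only: inner_diff_left inner_diff_right) (simp add: inner_commute)
  finally show ?thesis
    using closest_point_dot[OF assms(2,1,3), of y] by (simp add: norm_minus_commute)
qed

text \<open>By convexity the average of the projections lies in \<open>Y\<close>, so it competes
  with the projection of the average.\<close>

lemma proj_dist_average_le:
  fixes x :: "nat \<Rightarrow> 'a::euclidean_space"
  assumes Y: "closed Y" "convex Y" "Y \<noteq> {}" and "K > 0"
  shows "proj_dist Y ((1 / real K) *\<^sub>R (\<Sum>i<K. x i)) \<le> (\<Sum>i<K. proj_dist Y (x i)) / real K"
proof -
  define p where "p i = closest_point Y (x i)" for i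
  have "(\<Sum>i<K. (1 / real K) *\<^sub>R p i) \<in> Y"
    using \<open>K > 0\<close> Y by (intro convex_sum) (auto simp: p_def closest_point_in_set)
  then have "proj_dist Y ((1 / real K) *\<^sub>R (\<Sum>i<K. x i))
      \<le> norm ((1 / real K) *\<^sub>R (\<Sum>i<K. x i) - (\<Sum>i<K. (1 / real K) *\<^sub>R p i))"
    by (intro proj_dist_le Y)
  also have "\<dots> = norm (\<Sum>i<K. x i - p i) / real K"
    by (simp add: scaleR_sum_right[symmetric] scaleR_diff_right[symmetric] sum_subtractf[symmetric])
  also have "\<dots> \<le> (\<Sum>i<K. proj_dist Y (x i)) / real K"
    by (intro divide_right_mono sum_norm_le) (auto simp: p_def proj_dist_def)
  finally show ?thesis .
qed

lemma power2_average_le: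
  fixes x :: "nat \<Rightarrow> real"
  assumes "K > 0"
  shows "((\<Sum>i<K. x i) / real K)\<^sup>2 \<le> (\<Sum>i<K. (x i)\<^sup>2) / real K"
proof -
  have "(\<Sum>i<K. x i)\<^sup>2 \<le> real K * (\<Sum>i<K. (x i)\<^sup>2)"
    using Cauchy_Schwarz_ineq_sum[of "\<lambda>_. 1" x "{..<K}"] by simp
  then show ?thesis
    using assms by (simp add: power_divide divide_simps power2_eq_square mult.commute)
qed

lemma convex_on_average_le:
  fixes x :: "nat \<Rightarrow> 'a::euclidean_space"
  assumes "convex_on UNIV g" "K > 0"
  shows "g ((1 / real K) *\<^sub>R (\<Sum>i<K. x i)) \<le> (\<Sum>i<K. g (x i)) / real K"
proof -
  have "g (\<Sum>i<K. (1 / real K) *\<^sub>R x i) \<le> (\<Sum>i<K. (1 / real K) * g (x i))"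
    using assms by (intro convex_on_sum) auto
  then show ?thesis by (simp add: scaleR_sum_right sum_divide_distrib)
qed

lemma lipschitz_real_le:
  fixes g :: "'a::real_normed_vector \<Rightarrow> real"
  assumes "l-lipschitz_on UNIV g"
  shows "\<bar>g x - g y\<bar> \<le> l * norm (x - y)"
  using lipschitz_onD[OF assms, of x y] by (simp add: dist_norm)

text \<open>The last term measures exactly how strongly convex the squared norm is;
  \<open>prox_three_point\<close> draws its extra square from it.\<close>

lemma norm_convex_combination:
  fixes a b :: "'a::real_inner"
  shows "(norm ((1 - t) *\<^sub>R a + t *\<^sub>R b))\<^sup>2
    = (1 - t) * (norm a)\<^sup>2 + t * (norm b)\<^sup>2 - t * (1 - t) * (norm (a - b))\<^sup>2"
  unfolding power2_norm_eq_inner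
  by (simp add: inner_add_left inner_add_right inner_diff_left inner_diff_right
      inner_commute[of b a] algebra_simps)

text \<open>A Lipschitz function decreases at most linearly, so the quadratic term wins far from
  \<open>x\<close> and the search can be confined to a compact ball.\<close>

lemma prox_exists:
  fixes g :: "'a::euclidean_space \<Rightarrow> real"
  assumes "l-lipschitz_on UNIV g" "\<mu> > 0"
  shows "\<exists>y. \<forall>z. g y + 1 / (2 * \<mu>) * (norm (y - x))\<^sup>2 \<le> g z + 1 / (2 * \<mu>) * (norm (z - x))\<^sup>2"
proof -
  let ?h = "\<lambda>z. g z + 1 / (2 * \<mu>) * (norm (z - x))\<^sup>2"
  have l: "l \<ge> 0" using assms(1) by (rule lipschitz_on_nonneg)
  \<comment> \<open>At distance \<open>r\<close> from \<open>x\<close> the quadratic term equals the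
    largest decrease \<open>l * r\<close> that the Lipschitz bound permits.\<close>
  define r where "r = 2 * \<mu> * l"
  have r: "r \<ge> 0" using l assms by (simp add: r_def)
  have "continuous_on UNIV g" using assms(1) by (rule lipschitz_on_continuous_on)
  then have "continuous_on (cball x r) ?h"
    by (intro continuous_intros) (auto intro: continuous_on_subset)
  then obtain y where y: "\<forall>z\<in>cball x r. ?h y \<le> ?h z"
    using continuous_attains_inf[of "cball x r" ?h] r by fastforce
  have "?h y \<le> ?h z" for z
  proof (cases "z \<in> cball x r")
    case False
    then have t: "r \<le> norm (z - x)" by (simp add: dist_norm norm_minus_commute)
    have "g x - g z \<le> l * norm (z - x)"
      using lipschitz_real_le[OF assms(1), of x z] by (simp add: norm_minus_commute)
    also have "\<dots> = 1 / (2 * \<mu>) * (r * norm (z - x))" using assms by (simp add: r_def)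
    also have "\<dots> \<le> 1 / (2 * \<mu>) * (norm (z - x))\<^sup>2"
      unfolding power2_eq_square using t assms by (intro mult_left_mono mult_right_mono) auto
    finally have "?h x \<le> ?h z" by simp
    moreover have "?h y \<le> ?h x" using y r by (meson centre_in_cball)
    ultimately show ?thesis by linarith
  qed (use y in blast)
  then show ?thesis by blast
qed

text \<open>\<open>arg_min\<close> is a choice operator, so its minimality is available only once
  some minimizer is known to exist.\<close>

lemma prox_le:
  fixes g :: "'a::euclidean_space \<Rightarrow> real"
  assumes "l-lipschitz_on UNIV g" "\<mu> > 0"
  shows "g (prox \<mu> g x) + 1 / (2 * \<mu>) * (norm (prox \<mu> g x - x))\<^sup>2
    \<le> g z + 1 / (2 * \<mu>) * (norm (z - x))\<^sup>2"
proof -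
  let ?h = "\<lambda>z. g z + 1 / (2 * \<mu>) * (norm (z - x))\<^sup>2"
  obtain y where "\<forall>z. ?h y \<le> ?h z" using prox_exists[OF assms, of x] by blast
  then have "is_arg_min ?h (\<lambda>_. True) y" by (auto simp: is_arg_min_def not_less)
  then have "is_arg_min ?h (\<lambda>_. True) (prox \<mu> g x)"
    unfolding prox_def arg_min_def by (rule someI)
  then show ?thesis by (auto simp: is_arg_min_def not_less)
qed

text \<open>The objective of the proximal problem is strongly convex with modulus \<open>1/\<mu>\<close>: compare
  the minimizer with the points \<open>y + t (z - y)\<close> and let \<open>t\<close> tend to 0.\<close>

lemma prox_three_point:
  fixes g :: "'a::euclidean_space \<Rightarrow> real" and x z :: 'a
  assumes "l-lipschitz_on UNIV g" "convex_on UNIV g" "\<mu> > 0"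
  defines "y \<equiv> prox \<mu> g x"
  shows "g y + 1 / (2 * \<mu>) * (norm (y - x))\<^sup>2 + 1 / (2 * \<mu>) * (norm (z - y))\<^sup>2
    \<le> g z + 1 / (2 * \<mu>) * (norm (z - x))\<^sup>2"
proof -
  define c where "c = 1 / (2 * \<mu>)"
  let ?h = "\<lambda>z. g z + c * (norm (z - x))\<^sup>2"
  have *: "?h y + (1 - t) * (c * (norm (z - y))\<^sup>2) \<le> ?h z" if t: "0 < t" "t < 1" for t
  proof -
    define w where "w = (1 - t) *\<^sub>R y + t *\<^sub>R z"
    have "w - x = (1 - t) *\<^sub>R (y - x) + t *\<^sub>R (z - x)" by (simp add: w_def algebra_simps)
    then have nw: "(norm (w - x))\<^sup>2
        = (1 - t) * (norm (y - x))\<^sup>2 + t * (norm (z - x))\<^sup>2 - t * (1 - t) * (norm (z - y))\<^sup>2"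
      by (simp add: norm_convex_combination norm_minus_commute)
    have "g w \<le> (1 - t) * g y + t * g z"
      unfolding w_def using convex_onD[OF assms(2), of t y z] t by simp
    moreover have "?h y \<le> ?h w" unfolding y_def c_def by (rule prox_le[OF assms(1,3)])
    ultimately have "?h y \<le> (1 - t) * ?h y + t * ?h z - t * ((1 - t) * (c * (norm (z - y))\<^sup>2))"
      unfolding nw by (simp add: algebra_simps)
    then have "t * (?h y + (1 - t) * (c * (norm (z - y))\<^sup>2)) \<le> t * ?h z"
      by (simp add: algebra_simps)
    then show ?thesis using t by (simp add: mult_le_cancel_left)
  qed
  have "((\<lambda>t. ?h y + (1 - t) * (c * (norm (z - y))\<^sup>2)) \<longlongrightarrow> ?h y + (1 - 0) * (c * (norm (z - y))\<^sup>2))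
      (at_right 0)"
    by (intro tendsto_intros)
  moreover have "eventually (\<lambda>t. ?h y + (1 - t) * (c * (norm (z - y))\<^sup>2) \<le> ?h z) (at_right (0::real))"
    by (rule eventually_mono[OF eventually_at_right_real[of 0 "1::real"]]) (use * in auto)
  ultimately have "?h y + (1 - 0) * (c * (norm (z - y))\<^sup>2) \<le> ?h z"
    by (intro tendsto_upperbound) auto
  then show ?thesis by (simp add: c_def)
qed

text \<open>With \<open>z = x\<close> the three-point inequality counts the squared step twice.
  Plain minimality would give only the bound \<open>2 * \<mu> * l\<close>.\<close>

lemma prox_step_le:
  fixes g :: "'a::euclidean_space \<Rightarrow> real"
  assumes "l-lipschitz_on UNIV g" "convex_on UNIV g" "\<mu> > 0"
  shows "norm (prox \<mu> g x - x) \<le> \<mu> * l"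
proof -
  let ?t = "norm (prox \<mu> g x - x)"
  have "g (prox \<mu> g x) + 1 / (2 * \<mu>) * ?t\<^sup>2 + 1 / (2 * \<mu>) * ?t\<^sup>2 \<le> g x"
    using prox_three_point[OF assms, of x x] by (simp add: norm_minus_commute)
  moreover have "g x - g (prox \<mu> g x) \<le> l * ?t"
    using lipschitz_real_le[OF assms(1), of x "prox \<mu> g x"] by (simp add: norm_minus_commute)
  moreover have "1 / (2 * \<mu>) * ?t\<^sup>2 + 1 / (2 * \<mu>) * ?t\<^sup>2 = ?t\<^sup>2 / \<mu>"
    using assms(3) by (simp add: field_simps)
  ultimately have "?t\<^sup>2 / \<mu> \<le> l * ?t" by linarith
  then have "?t * ?t \<le> (\<mu> * l) * ?t"
    using assms(3) by (simp add: field_simps power2_eq_square)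
  moreover have "0 \<le> \<mu> * l" using lipschitz_on_nonneg[OF assms(1)] assms(3) by simp
  ultimately show ?thesis
    by (cases "?t = 0") (auto simp: mult_le_cancel_right)
qed

text \<open>The Lipschitz bound moves the function value from the new point \<open>y\<close> back to
  \<open>x\<close>. This matters later: \<open>x\<close> will be an iterate independent of the
  current sample, whereas \<open>y\<close> depends on it.\<close>

lemma prox_descent:
  fixes g :: "'a::euclidean_space \<Rightarrow> real" and x z :: 'a
  assumes "l-lipschitz_on UNIV g" "convex_on UNIV g" "\<mu> > 0"
  defines "y \<equiv> prox \<mu> g x"
  shows "(norm (y - z))\<^sup>2 \<le> (norm (x - z))\<^sup>2 + 2 * \<mu> * (g z - g x)
    + 2 * (\<mu> * l) * norm (y - x) - (norm (y - x))\<^sup>2"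
proof -
  have "2 * \<mu> * (g y + 1 / (2 * \<mu>) * (norm (y - x))\<^sup>2 + 1 / (2 * \<mu>) * (norm (z - y))\<^sup>2)
      \<le> 2 * \<mu> * (g z + 1 / (2 * \<mu>) * (norm (z - x))\<^sup>2)"
    unfolding y_def using assms(3) by (intro mult_left_mono prox_three_point[OF assms(1-3)]) auto
  then have "2 * \<mu> * g y + (norm (y - x))\<^sup>2 + (norm (z - y))\<^sup>2
      \<le> 2 * \<mu> * g z + (norm (z - x))\<^sup>2"
    using assms(3) by (simp add: distrib_left)
  moreover have "2 * \<mu> * (g x - g y) \<le> 2 * \<mu> * (l * norm (y - x))"
    using lipschitz_real_le[OF assms(1), of x y] assms(3)
    by (intro mult_left_mono) (auto simp: norm_minus_commute)
  ultimately show ?thesis by (simp add: norm_minus_commute algebra_simps)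
qed

lemma prox_norm_le:
  fixes g :: "'a::euclidean_space \<Rightarrow> real"
  assumes "l-lipschitz_on UNIV g" "convex_on UNIV g" "\<mu> > 0"
  shows "norm (prox \<mu> g x - z) \<le> norm (x - z) + \<mu> * l"
  using prox_step_le[OF assms, of x] norm_triangle_ineq[of "prox \<mu> g x - x" "x - z"] by simp

text \<open>The projection is nonexpansive and fixes \<open>z\<close>. Being free of function
  values, the bound serves the induction for square integrability of the iterates.\<close>

lemma prox_closest_point_norm_le:
  fixes g :: "'a::euclidean_space \<Rightarrow> real"
  assumes "l-lipschitz_on UNIV g" "convex_on UNIV g" "\<mu> > 0"
    and "closed Y" "convex Y" "z \<in> Y"
  shows "norm (closest_point Y (prox \<mu> g x) - z) \<le> norm (x - z) + \<mu> * l"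
proof -
  have "dist (closest_point Y (prox \<mu> g x)) (closest_point Y z) \<le> dist (prox \<mu> g x) z"
    using assms by (intro closest_point_lipschitz) auto
  then show ?thesis
    using prox_norm_le[OF assms(1-3), of x z] assms(6) by (simp add: closest_point_self dist_norm)
qed

lemma prox_closest_point_descent:
  fixes g :: "'a::euclidean_space \<Rightarrow> real" and x z :: 'a
  assumes g: "l-lipschitz_on UNIV g" "convex_on UNIV g" and mu: "\<mu> > 0"
    and Y: "closed Y" "convex Y" "z \<in> Y"
  defines "x' \<equiv> closest_point Y (prox \<mu> g x)"
  shows "(norm (x' - z))\<^sup>2 \<le> (norm (x - z))\<^sup>2 + 2 * \<mu> * (g z - g x) + (\<mu> * l)\<^sup>2"
    and "(norm (x' - z))\<^sup>2 \<le> (norm (x - z))\<^sup>2 + 2 * \<mu> * (g z - g x)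
      + 4 * (\<mu> * l)\<^sup>2 - 3 / 4 * (proj_dist Y x)\<^sup>2"
proof -
  define y where "y = prox \<mu> g x"
  define m t e d where "m = \<mu> * l" and "t = norm (y - x)" and "e = proj_dist Y y"
    and "d = proj_dist Y x"
  have *: "(norm (x' - z))\<^sup>2 \<le> (norm (x - z))\<^sup>2 + 2 * \<mu> * (g z - g x) + (2 * m * t - t\<^sup>2 - e\<^sup>2)"
    using closest_point_pythagoras[OF Y, of y] prox_descent[OF g mu, of x z]
    by (simp add: x'_def y_def m_def t_def e_def)
  have "0 \<le> (m - t)\<^sup>2" by simp
  then have "2 * m * t - t\<^sup>2 \<le> m\<^sup>2" by (simp add: power2_diff)
  moreover have "0 \<le> e\<^sup>2" by simp
  ultimately have "2 * m * t - t\<^sup>2 - e\<^sup>2 \<le> m\<^sup>2" by linarith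
  with * show "(norm (x' - z))\<^sup>2 \<le> (norm (x - z))\<^sup>2 + 2 * \<mu> * (g z - g x) + (\<mu> * l)\<^sup>2"
    by (simp add: m_def)
  have t: "0 \<le> t" "t \<le> m"
    using prox_step_le[OF g mu, of x] by (auto simp: t_def m_def y_def)
  have "d \<le> e + t"
    using proj_dist_triangle[of Y x y] Y by (auto simp: d_def e_def t_def norm_minus_commute)
  moreover have "0 \<le> d" "0 \<le> e" by (auto simp: d_def e_def proj_dist_nonneg)
  ultimately have "d\<^sup>2 \<le> (e + t)\<^sup>2" by (intro power_mono)
  \<comment> \<open>The weight 3 gives
    \<open>(e + t)\<^sup>2 \<le> 4 / 3 * e\<^sup>2 + 4 * t\<^sup>2\<close>, so that
    \<open>3 / 4 * d\<^sup>2\<close> costs exactly the one \<open>e\<^sup>2\<close> gained by the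
    projection.\<close>
  moreover have "0 \<le> (e - 3 * t)\<^sup>2" by simp
  ultimately have "3 / 4 * d\<^sup>2 \<le> e\<^sup>2 + 3 * t\<^sup>2"
    by (simp add: power2_eq_square algebra_simps)
  moreover have "m * t \<le> m\<^sup>2" "t\<^sup>2 \<le> m\<^sup>2"
    using t by (auto simp: power2_eq_square intro!: mult_mono)
  ultimately have "2 * m * t - t\<^sup>2 - e\<^sup>2 \<le> 4 * m\<^sup>2 - 3 / 4 * d\<^sup>2" by linarith
  with * show "(norm (x' - z))\<^sup>2 \<le> (norm (x - z))\<^sup>2 + 2 * \<mu> * (g z - g x)
      + 4 * (\<mu> * l)\<^sup>2 - 3 / 4 * (proj_dist Y x)\<^sup>2"
    by (simp add: m_def d_def)
qed

subsection \<open>Measurable dependence on the sample\<close>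

text \<open>A point determined by an approximation gap \<open>G\<close> depends measurably on the data: take the
  first element of a countable set whose gap is below \<open>1/(n+1)\<close> and let \<open>n\<close> tend to infinity.\<close>

lemma borel_measurable_gap_selection:
  fixes g :: "'w \<Rightarrow> 'a::euclidean_space" and q :: "nat \<Rightarrow> 'a" and G :: "'w \<Rightarrow> nat \<Rightarrow> real"
  assumes G[measurable]: "\<And>i. (\<lambda>w. G w i) \<in> borel_measurable N"
    and nonneg: "\<And>w i. w \<in> space N \<Longrightarrow> 0 \<le> G w i"
    and small: "\<And>w \<delta>. w \<in> space N \<Longrightarrow> 0 < \<delta> \<Longrightarrow> \<exists>i. G w i < \<delta>"
    and gap: "\<And>w i. w \<in> space N \<Longrightarrow> norm (q i - g w) \<le> \<psi> w (G w i)"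
    and psi: "\<And>w. w \<in> space N \<Longrightarrow> isCont (\<psi> w) 0 \<and> \<psi> w 0 = 0"
  shows "g \<in> borel_measurable N"
proof -
  define I where "I n w = (LEAST i. G w i < inverse (real (Suc n)))" for n w
  show ?thesis
  proof (rule borel_measurable_LIMSEQ_metric)
    show "(\<lambda>w. q (I n w)) \<in> borel_measurable N" for n
      unfolding I_def by (rule measurable_compose_countable) measurable
    fix w assume w: "w \<in> space N"
    have I: "G w (I n w) < inverse (real (Suc n))" for n
      unfolding I_def by (rule LeastI_ex) (use small[OF w, of "inverse (real (Suc n))"] in simp)
    have "(\<lambda>n. G w (I n w)) \<longlonglongrightarrow> 0"
      by (rule tendsto_sandwich[OF _ _ tendsto_const LIMSEQ_inverse_real_of_nat])
        (use nonneg[OF w] less_imp_le[OF I] in simp_all)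
    then have "(\<lambda>n. \<psi> w (G w (I n w))) \<longlonglongrightarrow> \<psi> w 0"
      using isCont_tendsto_compose[of 0 "\<psi> w"] psi[OF w] by simp
    then have "(\<lambda>n. \<psi> w (G w (I n w))) \<longlonglongrightarrow> 0" using psi[OF w] by simp
    then have "(\<lambda>n. q (I n w) - g w) \<longlonglongrightarrow> 0"
      by (rule Lim_null_comparison[OF always_eventually, rotated]) (use gap[OF w] in blast)
    then show "(\<lambda>n. q (I n w)) \<longlonglongrightarrow> g w" by (simp add: LIM_zero_iff)
  qed
qed

text \<open>Approximate the first argument by simple functions: on their finitely many values
  measurability in \<open>s\<close> suffices, and continuity in \<open>x\<close> passes to the
  limit.\<close>

lemma borel_measurable_caratheodory:
  fixes F :: "'s \<Rightarrow> 'a::euclidean_space \<Rightarrow> real"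
  assumes meas: "\<And>x. (\<lambda>s. F s x) \<in> borel_measurable M"
    and cont: "\<And>s. s \<in> space M \<Longrightarrow> continuous_on UNIV (F s)"
  shows "(\<lambda>(x, s). F s x) \<in> borel_measurable (borel \<Otimes>\<^sub>M M)"
proof -
  obtain T :: "nat \<Rightarrow> 'a \<Rightarrow> 'a" where T: "\<And>i. simple_function borel (T i)"
      "\<And>x. (\<lambda>i. T i x) \<longlonglongrightarrow> x"
    using borel_measurable_implies_sequence_metric[of "\<lambda>x. x" borel 0] by auto
  show ?thesis
  proof (rule borel_measurable_LIMSEQ_metric)
    fix i
    have fin: "finite (range (T i))" using simple_functionD(1)[OF T(1), of i] by simp
    have "T i \<in> borel \<rightarrow>\<^sub>M count_space (range (T i))"
      using simple_functionD(2)[OF T(1)] by (simp add: measurable_count_space_eq2[OF fin])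
    from measurable_compose[OF measurable_fst this]
    have "(\<lambda>z. T i (fst z)) \<in> borel \<Otimes>\<^sub>M M \<rightarrow>\<^sub>M count_space (range (T i))" .
    moreover have "(\<lambda>z. F (snd z) x) \<in> borel_measurable (borel \<Otimes>\<^sub>M M)" for x
      by (rule measurable_compose[OF measurable_snd meas])
    ultimately have "(\<lambda>z. F (snd z) (T i (fst z))) \<in> borel_measurable (borel \<Otimes>\<^sub>M M)"
      using measurable_compose_countable'[where f = "\<lambda>x z. F (snd z) x" and g = "\<lambda>z. T i (fst z)"]
        countable_finite[OF fin] by blast
    then show "(\<lambda>z. F (snd z) (T i (fst z))) \<in> borel_measurable (borel \<Otimes>\<^sub>M M)" .
  next
    fix z :: "'a \<times> 's" assume "z \<in> space (borel \<Otimes>\<^sub>M M)"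
    then have "snd z \<in> space M" by (auto simp: space_pair_measure)
    then have "isCont (F (snd z)) (fst z)" using cont continuous_on_eq_continuous_at by blast
    then show "(\<lambda>i. F (snd z) (T i (fst z))) \<longlonglongrightarrow> (case z of (x, s) \<Rightarrow> F s x)"
      using T(2) by (auto simp: case_prod_beta intro: isCont_tendsto_compose)
  qed
qed

text \<open>Enumerating the dense set by natural numbers prepares the choice of a least index in
  \<open>borel_measurable_gap_selection\<close>.\<close>

lemma dense_sequence_exists:
  obtains q :: "nat \<Rightarrow> 'a::euclidean_space" where "\<And>x e. 0 < e \<Longrightarrow> \<exists>i. norm (q i - x) < e"
proof -
  obtain D :: "'a set" where D: "countable D" "\<And>U. open U \<Longrightarrow> U \<noteq> {} \<Longrightarrow> \<exists>d\<in>D. d \<in> U"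
    by (erule countable_dense_setE)
  have "\<exists>i. norm (from_nat_into D i - x) < e" if "0 < e" for x e
  proof -
    obtain d where "d \<in> D" "d \<in> ball x e" using D(2)[of "ball x e"] \<open>0 < e\<close> by auto
    moreover obtain i where "d = from_nat_into D i"
      using from_nat_into_surj[OF D(1) \<open>d \<in> D\<close>] by blast
    ultimately show ?thesis by (auto simp: dist_norm norm_minus_commute)
  qed
  then show thesis by (rule that)
qed

text \<open>The gap is the excess of the proximal objective over its infimum. By strong convexity an
  excess \<open>t\<close> confines a point to distance \<open>sqrt (2 * \<mu> * t)\<close> from the
  minimizer.\<close>

lemma borel_measurable_prox:
  fixes f :: "'s \<Rightarrow> 'a::euclidean_space \<Rightarrow> real"
  assumes meas: "\<And>x. (\<lambda>s. f s x) \<in> borel_measurable M"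
    and lip: "\<And>s. s \<in> space M \<Longrightarrow> (L s)-lipschitz_on UNIV (f s)"
    and conv: "\<And>s. s \<in> space M \<Longrightarrow> convex_on UNIV (f s)"
    and "\<mu> > 0"
  shows "(\<lambda>(x, s). prox \<mu> (f s) x) \<in> borel_measurable (borel \<Otimes>\<^sub>M M)"
proof -
  obtain q :: "nat \<Rightarrow> 'a" where q: "\<And>x e. 0 < e \<Longrightarrow> \<exists>i. norm (q i - x) < e"
    using dense_sequence_exists by blast
  define h where "h w z = f (snd w) z + 1 / (2 * \<mu>) * (norm (z - fst w))\<^sup>2" for w and z :: 'a
  define p where "p w = prox \<mu> (f (snd w)) (fst w)" for w
  define v where "v w = (INF i. h w (q i))" for w
  have [measurable]: "(\<lambda>w. f (snd w) z) \<in> borel_measurable (borel \<Otimes>\<^sub>M M)" for z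
    by (rule measurable_compose[OF measurable_snd meas])
  have h_meas[measurable]: "(\<lambda>w. h w z) \<in> borel_measurable (borel \<Otimes>\<^sub>M M)" for z
    unfolding h_def by measurable
  have [measurable]: "v \<in> borel_measurable (borel \<Otimes>\<^sub>M M)"
    unfolding v_def by measurable
  have min: "h w (p w) + 1 / (2 * \<mu>) * (norm (z - p w))\<^sup>2 \<le> h w z" if "snd w \<in> space M" for w z
    unfolding h_def p_def using prox_three_point[OF lip conv] that \<open>\<mu> > 0\<close> by blast
  have "0 \<le> 1 / (2 * \<mu>) * (norm (z - p w))\<^sup>2" for z w using \<open>\<mu> > 0\<close> by simp
  with min have ph: "h w (p w) \<le> h w z" if "snd w \<in> space M" for w z
    using that by (smt (verit, best))
  have bdd: "bdd_below (range (\<lambda>i. h w (q i)))" if "snd w \<in> space M" for w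
    using ph[OF that] by (auto intro!: bdd_belowI)
  \<comment> \<open>The minimizer need not belong to the sequence; continuity of the objective and
    density show that the countable, hence measurable, infimum still does not exceed the
    minimum.\<close>
  have v_le: "v w \<le> h w (p w)" if w: "snd w \<in> space M" for w
  proof (rule field_le_epsilon)
    fix e :: real assume "e > 0"
    have "continuous_on UNIV (f (snd w))" using lip[OF w] by (rule lipschitz_on_continuous_on)
    then have "continuous_on UNIV (h w)" unfolding h_def by (intro continuous_intros)
    then have "isCont (h w) (p w)" using continuous_on_eq_continuous_at by blast
    then obtain d where d: "d > 0" "\<And>z. dist z (p w) < d \<Longrightarrow> dist (h w z) (h w (p w)) < e"
      using \<open>e > 0\<close> unfolding continuous_at_eps_delta by blast
    obtain i where "norm (q i - p w) < d" using q[OF d(1)] by blast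
    then have "dist (h w (q i)) (h w (p w)) < e" by (intro d(2)) (simp add: dist_norm)
    then have "h w (q i) \<le> h w (p w) + e" by (simp add: dist_real_def)
    moreover have "v w \<le> h w (q i)" unfolding v_def using bdd[OF w] by (rule cINF_lower) simp
    ultimately show "v w \<le> h w (p w) + e" by linarith
  qed
  have "p \<in> borel_measurable (borel \<Otimes>\<^sub>M M)"
  proof (rule borel_measurable_gap_selection[where q = q and G = "\<lambda>w i. h w (q i) - v w"
        and \<psi> = "\<lambda>_ t. sqrt (2 * \<mu> * t)"])
    fix w :: "'a \<times> 's" assume "w \<in> space (borel \<Otimes>\<^sub>M M)"
    then have w: "snd w \<in> space M" by (auto simp: space_pair_measure)
    show "isCont (\<lambda>t. sqrt (2 * \<mu> * t)) 0 \<and> sqrt (2 * \<mu> * 0) = 0"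
      by (auto intro!: continuous_intros)
    fix i
    show "0 \<le> h w (q i) - v w" using bdd[OF w] by (auto simp: v_def intro!: cINF_lower)
    have "1 / (2 * \<mu>) * (norm (q i - p w))\<^sup>2 \<le> h w (q i) - v w"
      using min[OF w, of "q i"] v_le[OF w] by linarith
    then have "(norm (q i - p w))\<^sup>2 \<le> 2 * \<mu> * (h w (q i) - v w)"
      using \<open>\<mu> > 0\<close> by (simp add: pos_divide_le_eq mult.commute)
    then show "norm (q i - p w) \<le> sqrt (2 * \<mu> * (h w (q i) - v w))" by (rule real_le_rsqrt)
  next
    fix w :: "'a \<times> 's" and \<delta> :: real assume "w \<in> space (borel \<Otimes>\<^sub>M M)" "\<delta> > 0"
    then have "\<exists>i. h w (q i) < v w + \<delta>"
      using cINF_less_iff[OF _ bdd, of w "v w + \<delta>"] by (auto simp: space_pair_measure v_def)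
    then show "\<exists>i. h w (q i) - v w < \<delta>" by (auto simp: algebra_simps)
  qed measurable
  then show ?thesis by (simp add: p_def[abs_def] case_prod_beta')
qed

text \<open>Points of the sequence \<open>q\<close> may all miss the set, so being nearly as close
  to \<open>x\<close> as the projection is not enough. The gap therefore also includes the distance
  of \<open>q i\<close> to the set.\<close>

lemma borel_measurable_closest_point:
  fixes X :: "'s \<Rightarrow> 'a::euclidean_space set"
  assumes meas: "\<And>x. (\<lambda>s. proj_dist (X s) x) \<in> borel_measurable M"
    and X: "\<And>s. s \<in> space M \<Longrightarrow> closed (X s)" "\<And>s. s \<in> space M \<Longrightarrow> convex (X s)"
      "\<And>s. s \<in> space M \<Longrightarrow> X s \<noteq> {}"
  shows "(\<lambda>(x, s). closest_point (X s) x) \<in> borel_measurable (borel \<Otimes>\<^sub>M M)"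
proof -
  obtain q :: "nat \<Rightarrow> 'a" where q: "\<And>x e. 0 < e \<Longrightarrow> \<exists>i. norm (q i - x) < e"
    using dense_sequence_exists by blast
  define d where "d w z = proj_dist (X (snd w)) z" for w :: "'a \<times> 's" and z
  define p where "p w = closest_point (X (snd w)) (fst w)" for w
  define G where "G w i = max (d w (q i)) (norm (fst w - q i) - d w (fst w))" for w i
  have [measurable]: "(\<lambda>w. d w z) \<in> borel_measurable (borel \<Otimes>\<^sub>M M)" for z
    unfolding d_def by (rule measurable_compose[OF measurable_snd meas])
  have [measurable]: "(\<lambda>w. d w (fst w)) \<in> borel_measurable (borel \<Otimes>\<^sub>M M)"
    using borel_measurable_caratheodory[of "\<lambda>s. proj_dist (X s)", OF meas continuous_on_proj_dist[OF X]]
    by (simp add: d_def case_prod_beta')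
  have "p \<in> borel_measurable (borel \<Otimes>\<^sub>M M)"
  proof (rule borel_measurable_gap_selection[where q = q and G = G
        and \<psi> = "\<lambda>w t. sqrt ((d w (fst w) + 2 * t)\<^sup>2 - (d w (fst w))\<^sup>2) + t"])
    fix i
    show "(\<lambda>w. G w i) \<in> borel_measurable (borel \<Otimes>\<^sub>M M)" unfolding G_def by measurable
  next
    fix w :: "'a \<times> 's" assume "w \<in> space (borel \<Otimes>\<^sub>M M)"
    then have "snd w \<in> space M" by (auto simp: space_pair_measure)
    note Xw = X[OF this]
    show "isCont (\<lambda>t. sqrt ((d w (fst w) + 2 * t)\<^sup>2 - (d w (fst w))\<^sup>2) + t) 0
        \<and> sqrt ((d w (fst w) + 2 * 0)\<^sup>2 - (d w (fst w))\<^sup>2) + 0 = 0"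
      by (auto intro!: continuous_intros)
    fix i
    show G0: "0 \<le> G w i" by (simp add: G_def d_def proj_dist_nonneg le_max_iff_disj)
    \<comment> \<open>The Pythagorean inequality needs a point of the set. The projection of
      \<open>q i\<close> is one, and replacing \<open>q i\<close> by it costs at most the gap once
      more.\<close>
    define r where "r = closest_point (X (snd w)) (q i)"
    have "r \<in> X (snd w)" unfolding r_def using Xw by (intro closest_point_in_set)
    have qr: "norm (q i - r) \<le> G w i" by (simp add: G_def d_def r_def proj_dist_def)
    have "norm (fst w - r) \<le> norm (fst w - q i) + norm (q i - r)"
      using norm_triangle_ineq[of "fst w - q i" "q i - r"] by simp
    also have "\<dots> \<le> d w (fst w) + 2 * G w i" using qr by (simp add: G_def max_def split: if_splits)
    finally have "(norm (fst w - r))\<^sup>2 \<le> (d w (fst w) + 2 * G w i)\<^sup>2" by (intro power_mono) auto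
    moreover have "(norm (p w - r))\<^sup>2 \<le> (norm (fst w - r))\<^sup>2 - (d w (fst w))\<^sup>2"
      unfolding p_def d_def by (rule closest_point_pythagoras[OF Xw(1,2) \<open>r \<in> X (snd w)\<close>])
    ultimately have "norm (p w - r) \<le> sqrt ((d w (fst w) + 2 * G w i)\<^sup>2 - (d w (fst w))\<^sup>2)"
      by (intro real_le_rsqrt) linarith
    then show "norm (q i - p w) \<le> sqrt ((d w (fst w) + 2 * G w i)\<^sup>2 - (d w (fst w))\<^sup>2) + G w i"
      using qr norm_triangle_ineq[of "q i - r" "r - p w"] by (simp add: norm_minus_commute)
  next
    fix w :: "'a \<times> 's" and \<delta> :: real assume "w \<in> space (borel \<Otimes>\<^sub>M M)" "\<delta> > 0"
    then have "snd w \<in> space M" by (auto simp: space_pair_measure)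
    note Xw = X[OF this]
    have pX: "p w \<in> X (snd w)" unfolding p_def using Xw by (intro closest_point_in_set)
    obtain i where i: "norm (q i - p w) < \<delta>" using q[OF \<open>\<delta> > 0\<close>] by blast
    have "d w (q i) < \<delta>" using proj_dist_le[OF Xw(1) pX, of "q i"] i by (simp add: d_def)
    moreover have "norm (fst w - q i) \<le> d w (fst w) + norm (q i - p w)"
      using norm_triangle_ineq[of "fst w - p w" "p w - q i"]
      by (simp add: d_def proj_dist_def p_def norm_minus_commute)
    ultimately show "\<exists>i. G w i < \<delta>" using i by (intro exI[of _ i]) (simp add: G_def)
  qed
  then show ?thesis by (simp add: p_def[abs_def] case_prod_beta')
qed

subsection \<open>Expectations along the iteration\<close>

text \<open>The stepsize is an arbitrary positive number here; its prescribed value enters only in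
  the final theorem, where the bounds are balanced.\<close>

locale spp_setting = M: prob_space M + P: prob_space P
  for M :: "'s measure" and P :: "'w measure" +
  fixes S :: "nat \<Rightarrow> 'w \<Rightarrow> 's"
    and f :: "'s \<Rightarrow> 'a::euclidean_space \<Rightarrow> real"
    and X :: "'s \<Rightarrow> 'a set"
    and L :: "'s \<Rightarrow> real"
    and x0 xstar :: 'a
    and \<kappa> \<mu> B :: real
  assumes indep_S: "P.indep_vars (\<lambda>_. M) S UNIV"
    and distr_S: "\<And>k. distr P M (S k) = M"
    and f_integrable: "\<And>x. integrable M (\<lambda>s. f s x)"
    and f_convex: "\<And>s. s \<in> space M \<Longrightarrow> convex_on UNIV (f s)"
    and L_pos: "\<And>s. s \<in> space M \<Longrightarrow> L s > 0"
    and f_lipschitz: "\<And>s. s \<in> space M \<Longrightarrow> (L s)-lipschitz_on UNIV (f s)"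
    and L_sq_integrable: "integrable M (\<lambda>s. (L s)\<^sup>2)"
    and X_closed: "\<And>s. s \<in> space M \<Longrightarrow> closed (X s)"
    and X_convex: "\<And>s. s \<in> space M \<Longrightarrow> convex (X s)"
    and X_measurable: "\<And>x. (\<lambda>s. proj_dist (X s) x) \<in> borel_measurable M"
    and xstar_optimal: "optimal_solution M f X xstar"
    and kappa_pos: "\<kappa> > 0"
    and linear_regularity:
      "\<And>x. (proj_dist (feasible M X) x)\<^sup>2 \<le> \<kappa> * (\<integral>s. (proj_dist (X s) x)\<^sup>2 \<partial>M)"
    and B_eq: "B = (\<integral>s. (L s)\<^sup>2 \<partial>M)"
    and B_pos: "B > 0"
    and mu_pos: "\<mu> > 0"
begin

abbreviation F :: "'a \<Rightarrow> real" where "F \<equiv> objective M f"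
abbreviation C :: "'a set" where "C \<equiv> feasible M X"
abbreviation iter :: "nat \<Rightarrow> 'w \<Rightarrow> 'a" where "iter k \<omega> \<equiv> spp \<mu> f X x0 (\<lambda>i. S i \<omega>) k"

lemma xstar_in: "s \<in> space M \<Longrightarrow> xstar \<in> X s"
  using xstar_optimal by (auto simp: optimal_solution_def feasible_def)

lemma X_nonempty: "s \<in> space M \<Longrightarrow> X s \<noteq> {}"
  using xstar_in by blast

lemma C_closed: "closed C" and C_convex: "convex C" and C_nonempty: "C \<noteq> {}"
  using X_closed X_convex xstar_optimal
  by (auto simp: feasible_def optimal_solution_def intro!: convex_INT)

text \<open>The real \<open>INF\<close> is meaningful because the optimal point attains it, which
  also supplies the lower bound.\<close>

lemma opt_value_eq: "opt_value M f X = F xstar"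
  unfolding opt_value_def using xstar_optimal
  by (intro cInf_eq_minimum) (auto simp: optimal_solution_def)

lemma S_measurable[measurable]: "S k \<in> P \<rightarrow>\<^sub>M M"
  using indep_S by (auto simp: P.indep_vars_def)

lemma S_space: "\<omega> \<in> space P \<Longrightarrow> S k \<omega> \<in> space M"
  using measurable_space[OF S_measurable] .

text \<open>Measurability is known for the square of \<open>L\<close>; positivity recovers
  \<open>L\<close> as its square root.\<close>

lemma L_measurable[measurable]: "L \<in> borel_measurable M"
proof -
  have "(\<lambda>s. sqrt ((L s)\<^sup>2)) \<in> borel_measurable M" using L_sq_integrable by measurable
  moreover have "L \<in> borel_measurable M \<longleftrightarrow> (\<lambda>s. sqrt ((L s)\<^sup>2)) \<in> borel_measurable M"
    by (rule measurable_cong) (use less_imp_le[OF L_pos] in simp)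
  ultimately show ?thesis by simp
qed

lemma L_integrable: "integrable M L"
  by (rule M.square_integrable_imp_integrable[OF L_measurable L_sq_integrable])

text \<open>This is Jensen's inequality, obtained by integrating the arithmetic-geometric mean
  inequality that is tight at \<open>L s = sqrt B\<close>.\<close>

lemma expectation_L_le: "(\<integral>s. L s \<partial>M) \<le> sqrt B"
proof -
  have "(\<integral>s. L s \<partial>M) \<le> (\<integral>s. (L s)\<^sup>2 / (2 * sqrt B) + sqrt B / 2 \<partial>M)"
  proof (rule integral_mono[OF L_integrable])
    fix s
    have "0 \<le> (L s - sqrt B)\<^sup>2 / (2 * sqrt B)" using B_pos by simp
    also have "\<dots> = (L s)\<^sup>2 / (2 * sqrt B) + sqrt B / 2 - L s"
      using B_pos by (simp add: field_simps power2_eq_square)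
    finally show "L s \<le> (L s)\<^sup>2 / (2 * sqrt B) + sqrt B / 2" by simp
  qed (use L_sq_integrable in auto)
  also have "\<dots> = B / (2 * sqrt B) + sqrt B / 2"
    using L_sq_integrable by (simp add: B_eq M.prob_space)
  also have "\<dots> = sqrt B" using B_pos by (simp add: real_div_sqrt field_simps)
  finally show ?thesis .
qed

lemma F_lipschitz: "\<bar>F x - F y\<bar> \<le> sqrt B * norm (x - y)"
proof -
  have "\<bar>F x - F y\<bar> = \<bar>\<integral>s. f s x - f s y \<partial>M\<bar>"
    by (simp add: objective_def f_integrable)
  also have "\<dots> \<le> (\<integral>s. L s * norm (x - y) \<partial>M)"
    using integral_abs_bound[of M "\<lambda>s. f s x - f s y"]
  proof (rule order_trans)
    show "(\<integral>s. \<bar>f s x - f s y\<bar> \<partial>M) \<le> (\<integral>s. L s * norm (x - y) \<partial>M)"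
      using f_integrable L_integrable by (intro integral_mono lipschitz_real_le f_lipschitz) auto
  qed
  also have "\<dots> = (\<integral>s. L s \<partial>M) * norm (x - y)" by simp
  also have "\<dots> \<le> sqrt B * norm (x - y)" by (intro mult_right_mono expectation_L_le) simp
  finally show ?thesis .
qed

lemma F_measurable[measurable]: "F \<in> borel_measurable borel"
proof -
  have "(sqrt B)-lipschitz_on UNIV F"
    using F_lipschitz B_pos by (intro lipschitz_onI) (auto simp: dist_norm)
  then show ?thesis by (intro borel_measurable_continuous_onI lipschitz_on_continuous_on)
qed

lemma F_convex: "convex_on UNIV F"
proof (rule convex_onI)
  fix t :: real and x y :: 'a assume t: "0 < t" "t < 1"
  have "F ((1 - t) *\<^sub>R x + t *\<^sub>R y) \<le> (\<integral>s. (1 - t) * f s x + t * f s y \<partial>M)"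
    unfolding objective_def
    by (rule integral_mono) (use t f_integrable convex_onD[OF f_convex] in auto)
  also have "\<dots> = (1 - t) * F x + t * F y" by (simp add: objective_def f_integrable)
  finally show "F ((1 - t) *\<^sub>R x + t *\<^sub>R y) \<le> (1 - t) * F x + t * F y" .
qed simp

text \<open>Moving \<open>x\<close> to its projection on \<open>C\<close> produces a feasible point,
  whose value is at least the optimal one.\<close>

lemma optimality_gap_lower: "F xstar - F x \<le> sqrt B * proj_dist C x"
proof -
  have "closest_point C x \<in> C" by (intro closest_point_in_set C_closed C_nonempty)
  then have "F xstar \<le> F (closest_point C x)" using xstar_optimal by (simp add: optimal_solution_def)
  then show ?thesis
    using F_lipschitz[of x "closest_point C x"] unfolding proj_dist_def by linarith
qed

lemma proj_dist_C_measurable[measurable]: "proj_dist C \<in> borel_measurable borel"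
  by (intro borel_measurable_continuous_onI continuous_on_proj_dist C_closed C_convex C_nonempty)

lemma proj_dist_X_le:
  assumes "s \<in> space M"
  shows "proj_dist (X s) x \<le> proj_dist C x"
  unfolding proj_dist_def[of C]
  using closest_point_in_set[OF C_closed C_nonempty, of x] assms
  by (intro proj_dist_le X_closed) (auto simp: feasible_def)

lemma proj_dist_C_le: "proj_dist C x \<le> norm (x - xstar)"
  using xstar_optimal by (intro proj_dist_le C_closed) (simp add: optimal_solution_def)

text \<open>At a point outside \<open>C\<close> the squared distance to \<open>C\<close> is
  positive, so it can be cancelled from the regularity inequality after bounding each sampled
  distance by it.\<close>

lemma kappa_ge_1:
  assumes "C \<noteq> UNIV"
  shows "\<kappa> \<ge> 1"
proof -
  obtain x where "x \<notin> C" using assms by blast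
  then have pos: "0 < (proj_dist C x)\<^sup>2"
    using closest_point_in_set[OF C_closed C_nonempty, of x] by (auto simp: proj_dist_def)
  have "(proj_dist (X s) x)\<^sup>2 \<le> (proj_dist C x)\<^sup>2" if "s \<in> space M" for s
    using that by (intro power_mono proj_dist_X_le proj_dist_nonneg)
  moreover from this have "integrable M (\<lambda>s. (proj_dist (X s) x)\<^sup>2)"
    using X_measurable by (intro M.integrable_const_bound[where B = "(proj_dist C x)\<^sup>2"]) auto
  ultimately have "(\<integral>s. (proj_dist (X s) x)\<^sup>2 \<partial>M) \<le> (proj_dist C x)\<^sup>2"
    by (intro M.integral_le_const) auto
  then have "(proj_dist C x)\<^sup>2 \<le> \<kappa> * (proj_dist C x)\<^sup>2"
    using linear_regularity[of x] kappa_pos by (meson mult_left_mono less_imp_le order_trans)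
  then show ?thesis using pos by simp
qed

section \<open>Measurability, independence and integrability of the iterates\<close>

lemma f_measurable: "(\<lambda>(x, s). f s x) \<in> borel_measurable (borel \<Otimes>\<^sub>M M)"
  using f_integrable f_lipschitz
  by (intro borel_measurable_caratheodory) (auto intro: lipschitz_on_continuous_on)

lemma proj_dist_X_measurable: "(\<lambda>(x, s). proj_dist (X s) x) \<in> borel_measurable (borel \<Otimes>\<^sub>M M)"
  using X_measurable X_closed X_convex X_nonempty
  by (intro borel_measurable_caratheodory continuous_on_proj_dist) auto

text \<open>The maps \<open>T\<close> are general because two instances are used: the draws
  themselves, and the coordinates of a product over \<open>{..<k}\<close>, where only indices below
  \<open>k\<close> are available.\<close>

lemma spp_measurable:
  assumes "\<And>i. i < k \<Longrightarrow> T i \<in> N \<rightarrow>\<^sub>M M"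
  shows "(\<lambda>\<omega>. spp \<mu> f X x0 (\<lambda>i. T i \<omega>) k) \<in> borel_measurable N"
  using assms
proof (induction k)
  case (Suc k)
  have [measurable]: "T k \<in> N \<rightarrow>\<^sub>M M" using Suc.prems by simp
  have [measurable]: "(\<lambda>\<omega>. spp \<mu> f X x0 (\<lambda>i. T i \<omega>) k) \<in> borel_measurable N"
    using Suc by simp
  have "(\<lambda>(x, s). prox \<mu> (f s) x) \<in> borel_measurable (borel \<Otimes>\<^sub>M M)"
    using f_integrable f_lipschitz f_convex mu_pos
    by (intro borel_measurable_prox[where L = L]) auto
  from measurable_compose[OF _ this, of "\<lambda>\<omega>. (spp \<mu> f X x0 (\<lambda>i. T i \<omega>) k, T k \<omega>)" N]
  have [measurable]:
    "(\<lambda>\<omega>. prox \<mu> (f (T k \<omega>)) (spp \<mu> f X x0 (\<lambda>i. T i \<omega>) k)) \<in> borel_measurable N"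
    by simp
  have "(\<lambda>(x, s). closest_point (X s) x) \<in> borel_measurable (borel \<Otimes>\<^sub>M M)"
    using X_measurable X_closed X_convex X_nonempty by (intro borel_measurable_closest_point) auto
  from measurable_compose[OF _ this,
      of "\<lambda>\<omega>. (prox \<mu> (f (T k \<omega>)) (spp \<mu> f X x0 (\<lambda>i. T i \<omega>) k), T k \<omega>)" N]
  show ?case by simp
qed simp

lemma spp_cong: "(\<And>i. i < k \<Longrightarrow> s i = s' i) \<Longrightarrow> spp \<mu> f X x0 s k = spp \<mu> f X x0 s' k"
  by (induction k) auto

lemma iter_measurable[measurable]: "iter k \<in> borel_measurable P"
  by (rule spp_measurable) measurable

text \<open>The iterate is a function of the draws before \<open>k\<close>, hence independent of the
  draw \<open>S k\<close>, whose law is \<open>M\<close>.\<close>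

lemma distr_iter_sample:
  "distr P (borel \<Otimes>\<^sub>M M) (\<lambda>\<omega>. (iter k \<omega>, S k \<omega>)) = distr P borel (iter k) \<Otimes>\<^sub>M M"
proof -
  define U where "U \<omega> = restrict (\<lambda>i. S i \<omega>) {..<k}" for \<omega>
  define V where "V \<omega> = restrict (\<lambda>i. S i \<omega>) {k}" for \<omega>
  \<comment> \<open>\<open>\<Phi>\<close> reads the iterate off a tuple of draws. It ignores
    coordinates from \<open>k\<close> on, so the restricted tuple \<open>U\<close> determines the
    iterate.\<close>
  define \<Phi> where "\<Phi> s = spp \<mu> f X x0 s k" for s
  let ?A = "PiM {..<k} (\<lambda>_. M)" and ?B = "PiM {k} (\<lambda>_. M)"
  have "P.indep_var ?A U ?B V"
    unfolding U_def V_def by (rule P.indep_var_restrict[OF indep_S]) auto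
  then have [measurable]: "U \<in> P \<rightarrow>\<^sub>M ?A" "V \<in> P \<rightarrow>\<^sub>M ?B"
    and UV: "distr P ?A U \<Otimes>\<^sub>M distr P ?B V = distr P (?A \<Otimes>\<^sub>M ?B) (\<lambda>\<omega>. (U \<omega>, V \<omega>))"
    by (auto simp: P.indep_var_distribution_eq)
  have [measurable]: "\<Phi> \<in> borel_measurable ?A"
    using spp_measurable[of k "\<lambda>i s. s i" ?A] by (simp add: \<Phi>_def[abs_def])
  have PhiU: "\<Phi> (U \<omega>) = iter k \<omega>" for \<omega>
    by (auto simp: \<Phi>_def U_def intro!: spp_cong)
  have Vk: "V \<omega> k = S k \<omega>" for \<omega> by (simp add: V_def)
  have DU: "distr (distr P ?A U) borel \<Phi> = distr P borel (iter k)"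
    by (subst distr_distr) (simp_all add: comp_def PhiU)
  have DV: "distr (distr P ?B V) M (\<lambda>v. v k) = M"
    by (subst distr_distr) (simp_all add: comp_def Vk distr_S)
  have "distr P borel (iter k) \<Otimes>\<^sub>M M
      = distr (distr P ?A U) borel \<Phi> \<Otimes>\<^sub>M distr (distr P ?B V) M (\<lambda>v. v k)"
    by (simp only: DU DV)
  also have "\<dots> = distr (distr P ?A U \<Otimes>\<^sub>M distr P ?B V) (borel \<Otimes>\<^sub>M M) (\<lambda>(u, v). (\<Phi> u, v k))"
    by (rule pair_measure_distr) (simp_all add: DV M.sigma_finite_measure_axioms)
  also have "\<dots> = distr P (borel \<Otimes>\<^sub>M M) (\<lambda>\<omega>. (\<Phi> (U \<omega>), V \<omega> k))"
    unfolding UV by (subst distr_distr) (simp_all add: comp_def)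
  finally show ?thesis by (simp add: PhiU Vk)
qed

text \<open>Fubini on the product law plays the part of conditioning on the past: the fresh sample
  is averaged out with the iterate held fixed.\<close>

lemma expectation_iter_sample:
  fixes h :: "'a \<times> 's \<Rightarrow> real"
  assumes h: "h \<in> borel_measurable (borel \<Otimes>\<^sub>M M)"
    and int: "integrable P (\<lambda>\<omega>. h (iter k \<omega>, S k \<omega>))"
  shows "integrable P (\<lambda>\<omega>. \<integral>s. h (iter k \<omega>, s) \<partial>M)"
    and "(\<integral>\<omega>. h (iter k \<omega>, S k \<omega>) \<partial>P) = (\<integral>\<omega>. (\<integral>s. h (iter k \<omega>, s) \<partial>M) \<partial>P)"
proof -
  let ?D = "distr P borel (iter k)"
  interpret D: prob_space ?D by (rule P.prob_space_distr) simp
  interpret DM: pair_sigma_finite ?D M ..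
  have hD[measurable]: "h \<in> borel_measurable (?D \<Otimes>\<^sub>M M)"
    using h by (simp cong: measurable_cong_sets sets_pair_measure_cong)
  have "integrable (distr P (borel \<Otimes>\<^sub>M M) (\<lambda>\<omega>. (iter k \<omega>, S k \<omega>))) h"
    using h int by (subst integrable_distr_eq) auto
  then have intD: "integrable (?D \<Otimes>\<^sub>M M) h" unfolding distr_iter_sample .
  have meas: "(\<lambda>x. \<integral>s. h (x, s) \<partial>M) \<in> borel_measurable borel"
    using h by measurable
  have "integrable ?D (\<lambda>x. \<integral>s. h (x, s) \<partial>M)" using intD by (rule DM.integrable_fst')
  then show "integrable P (\<lambda>\<omega>. \<integral>s. h (iter k \<omega>, s) \<partial>M)"
    by (subst (asm) integrable_distr_eq) (use meas in auto)
  have "(\<integral>\<omega>. h (iter k \<omega>, S k \<omega>) \<partial>P) = integral\<^sup>L (?D \<Otimes>\<^sub>M M) h"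
    unfolding distr_iter_sample[symmetric] using h by (subst integral_distr) auto
  also have "\<dots> = (\<integral>x. (\<integral>s. h (x, s) \<partial>M) \<partial>?D)" using intD by (rule DM.integral_fst'[symmetric])
  also have "\<dots> = (\<integral>\<omega>. (\<integral>s. h (iter k \<omega>, s) \<partial>M) \<partial>P)"
    using meas by (subst integral_distr) auto
  finally show "(\<integral>\<omega>. h (iter k \<omega>, S k \<omega>) \<partial>P) = (\<integral>\<omega>. (\<integral>s. h (iter k \<omega>, s) \<partial>M) \<partial>P)" .
qed

lemma L_sample_sq:
  "integrable P (\<lambda>\<omega>. (L (S k \<omega>))\<^sup>2)" "(\<integral>\<omega>. (L (S k \<omega>))\<^sup>2 \<partial>P) = B"
proof -
  have "integrable (distr P M (S k)) (\<lambda>s. (L s)\<^sup>2)" using L_sq_integrable by (simp add: distr_S)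
  then show "integrable P (\<lambda>\<omega>. (L (S k \<omega>))\<^sup>2)" by (subst (asm) integrable_distr_eq) auto
  have "(\<integral>\<omega>. (L (S k \<omega>))\<^sup>2 \<partial>P) = (\<integral>s. (L s)\<^sup>2 \<partial>distr P M (S k))"
    by (subst integral_distr) auto
  then show "(\<integral>\<omega>. (L (S k \<omega>))\<^sup>2 \<partial>P) = B" by (simp add: distr_S B_eq)
qed

text \<open>One step adds at most \<open>\<mu> * L\<close> to the distance from
  \<open>xstar\<close>, and \<open>L\<close> has a finite second moment, so finiteness propagates
  from the deterministic start.\<close>

lemma iter_sq_integrable: "integrable P (\<lambda>\<omega>. (norm (iter k \<omega> - xstar))\<^sup>2)"
proof (induction k)
  case (Suc k)
  show ?case
  proof (rule Bochner_Integration.integrable_bound)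
    show "integrable P (\<lambda>\<omega>. 2 * (norm (iter k \<omega> - xstar))\<^sup>2 + 2 * \<mu>\<^sup>2 * (L (S k \<omega>))\<^sup>2)"
      using Suc L_sample_sq(1) by auto
    show "(\<lambda>\<omega>. (norm (iter (Suc k) \<omega> - xstar))\<^sup>2) \<in> borel_measurable P"
      using iter_measurable[of "Suc k"] by (simp del: spp.simps)
    show "AE \<omega> in P. norm ((norm (iter (Suc k) \<omega> - xstar))\<^sup>2)
        \<le> norm (2 * (norm (iter k \<omega> - xstar))\<^sup>2 + 2 * \<mu>\<^sup>2 * (L (S k \<omega>))\<^sup>2)"
    proof (rule AE_I2)
      fix \<omega> assume "\<omega> \<in> space P"
      then have s: "S k \<omega> \<in> space M" by (rule S_space)
      let ?a = "norm (iter k \<omega> - xstar)" and ?b = "\<mu> * L (S k \<omega>)"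
      have "norm (iter (Suc k) \<omega> - xstar) \<le> ?a + ?b"
        using prox_closest_point_norm_le[OF f_lipschitz[OF s] f_convex[OF s] mu_pos
            X_closed[OF s] X_convex[OF s] xstar_in[OF s]] by simp
      then have "(norm (iter (Suc k) \<omega> - xstar))\<^sup>2 \<le> (?a + ?b)\<^sup>2" by (intro power_mono) auto
      also have "\<dots> \<le> 2 * ?a\<^sup>2 + 2 * ?b\<^sup>2"
        using zero_le_power2[of "?a - ?b"] by (simp add: power2_sum power2_diff)
      finally show "norm ((norm (iter (Suc k) \<omega> - xstar))\<^sup>2)
          \<le> norm (2 * ?a\<^sup>2 + 2 * \<mu>\<^sup>2 * (L (S k \<omega>))\<^sup>2)"
        by (simp add: power_mult_distrib)
    qed
  qed
qed simp

text \<open>Averaging over the fresh sample turns the sampled gap into the gap of \<open>F\<close>.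
  Fubini is justified by the Lipschitz bound, a product dominated by a sum of two integrable
  squares.\<close>

lemma
  shows gap_sample_integrable: "integrable P (\<lambda>\<omega>. f (S k \<omega>) xstar - f (S k \<omega>) (iter k \<omega>))"
    and gap_iter_integrable: "integrable P (\<lambda>\<omega>. F xstar - F (iter k \<omega>))"
    and expectation_gap_sample: "(\<integral>\<omega>. f (S k \<omega>) xstar - f (S k \<omega>) (iter k \<omega>) \<partial>P)
      = (\<integral>\<omega>. F xstar - F (iter k \<omega>) \<partial>P)"
proof -
  define h where "h = (\<lambda>(x, s). f s xstar - f s x)"
  have "(\<lambda>w. f (snd w) xstar) \<in> borel_measurable ((borel :: 'a measure) \<Otimes>\<^sub>M M)"
    using f_integrable by (intro measurable_compose[OF measurable_snd]) auto
  then have h: "h \<in> borel_measurable (borel \<Otimes>\<^sub>M M)"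
    using f_measurable unfolding h_def case_prod_beta' by (rule borel_measurable_diff)
  have hs: "(\<lambda>\<omega>. h (iter k \<omega>, S k \<omega>)) \<in> borel_measurable P"
    using measurable_compose[OF _ h, of "\<lambda>\<omega>. (iter k \<omega>, S k \<omega>)" P] by simp
  have int: "integrable P (\<lambda>\<omega>. h (iter k \<omega>, S k \<omega>))"
  proof (rule Bochner_Integration.integrable_bound[OF _ hs])
    show "integrable P (\<lambda>\<omega>. (L (S k \<omega>))\<^sup>2 + (norm (iter k \<omega> - xstar))\<^sup>2)"
      using L_sample_sq(1) iter_sq_integrable by (rule Bochner_Integration.integrable_add)
    show "AE \<omega> in P. norm (h (iter k \<omega>, S k \<omega>))
        \<le> norm ((L (S k \<omega>))\<^sup>2 + (norm (iter k \<omega> - xstar))\<^sup>2)"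
    proof (rule AE_I2)
      fix \<omega> assume "\<omega> \<in> space P"
      then have s: "S k \<omega> \<in> space M" by (rule S_space)
      let ?l = "L (S k \<omega>)" and ?r = "norm (iter k \<omega> - xstar)"
      have "\<bar>h (iter k \<omega>, S k \<omega>)\<bar> \<le> ?l * ?r"
        using lipschitz_real_le[OF f_lipschitz[OF s], of xstar "iter k \<omega>"]
        by (simp add: h_def norm_minus_commute)
      also have "\<dots> \<le> ?l\<^sup>2 + ?r\<^sup>2"
        using zero_le_power2[of "?l - ?r"] zero_le_power2[of ?l] zero_le_power2[of ?r]
        unfolding power2_diff by linarith
      finally show "norm (h (iter k \<omega>, S k \<omega>)) \<le> norm (?l\<^sup>2 + ?r\<^sup>2)" by simp
    qed
  qed
  have inner: "(\<integral>s. h (x, s) \<partial>M) = F xstar - F x" for x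
    by (simp add: h_def objective_def f_integrable)
  show "integrable P (\<lambda>\<omega>. f (S k \<omega>) xstar - f (S k \<omega>) (iter k \<omega>))"
    using int by (simp add: h_def)
  show "integrable P (\<lambda>\<omega>. F xstar - F (iter k \<omega>))"
    using expectation_iter_sample(1)[OF h int] by (simp add: inner)
  show "(\<integral>\<omega>. f (S k \<omega>) xstar - f (S k \<omega>) (iter k \<omega>) \<partial>P) = (\<integral>\<omega>. F xstar - F (iter k \<omega>) \<partial>P)"
    using expectation_iter_sample(2)[OF h int] by (simp add: inner) (simp add: h_def)
qed

lemma proj_dist_C_sq_integrable:
  assumes [measurable]: "x \<in> borel_measurable P" and "integrable P (\<lambda>\<omega>. (norm (x \<omega> - xstar))\<^sup>2)"
  shows "integrable P (\<lambda>\<omega>. (proj_dist C (x \<omega>))\<^sup>2)"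
  by (rule Bochner_Integration.integrable_bound[OF assms(2)])
    (auto intro!: power_mono proj_dist_C_le proj_dist_nonneg)

lemma proj_dist_iter_sq_integrable: "integrable P (\<lambda>\<omega>. (proj_dist C (iter k \<omega>))\<^sup>2)"
  by (intro proj_dist_C_sq_integrable iter_measurable iter_sq_integrable)

text \<open>Linear regularity is applied at each realized iterate; averaging over the independent
  sample then replaces its inner expectation by the sampled distance.\<close>

lemma
  shows proj_dist_sample_integrable:
      "integrable P (\<lambda>\<omega>. (proj_dist (X (S k \<omega>)) (iter k \<omega>))\<^sup>2)"
    and expectation_proj_dist_sample:
      "(\<integral>\<omega>. (proj_dist C (iter k \<omega>))\<^sup>2 \<partial>P)
        \<le> \<kappa> * (\<integral>\<omega>. (proj_dist (X (S k \<omega>)) (iter k \<omega>))\<^sup>2 \<partial>P)"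
proof -
  define h where "h = (\<lambda>(x, s). (proj_dist (X s) x)\<^sup>2)"
  have h: "h \<in> borel_measurable (borel \<Otimes>\<^sub>M M)"
    using proj_dist_X_measurable by (simp add: h_def case_prod_beta')
  have hs: "(\<lambda>\<omega>. h (iter k \<omega>, S k \<omega>)) \<in> borel_measurable P"
    using measurable_compose[OF _ h, of "\<lambda>\<omega>. (iter k \<omega>, S k \<omega>)" P] by simp
  have int: "integrable P (\<lambda>\<omega>. h (iter k \<omega>, S k \<omega>))"
    by (rule Bochner_Integration.integrable_bound[OF proj_dist_iter_sq_integrable[of k] hs])
      (auto simp: h_def intro!: power_mono proj_dist_X_le proj_dist_nonneg S_space)
  then show "integrable P (\<lambda>\<omega>. (proj_dist (X (S k \<omega>)) (iter k \<omega>))\<^sup>2)" by (simp add: h_def)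
  have "(\<integral>\<omega>. (proj_dist C (iter k \<omega>))\<^sup>2 \<partial>P) \<le> (\<integral>\<omega>. \<kappa> * (\<integral>s. h (iter k \<omega>, s) \<partial>M) \<partial>P)"
    using expectation_iter_sample(1)[OF h int] proj_dist_iter_sq_integrable linear_regularity
    by (intro integral_mono) (auto simp: h_def)
  also have "\<dots> = \<kappa> * (\<integral>\<omega>. h (iter k \<omega>, S k \<omega>) \<partial>P)"
    by (simp add: expectation_iter_sample(2)[OF h int])
  finally show "(\<integral>\<omega>. (proj_dist C (iter k \<omega>))\<^sup>2 \<partial>P)
        \<le> \<kappa> * (\<integral>\<omega>. (proj_dist (X (S k \<omega>)) (iter k \<omega>))\<^sup>2 \<partial>P)"
    by (simp add: h_def)
qed

section \<open>Recursions in expectation and their sums\<close>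

text \<open>Both pointwise descents are integrated. In the second one, linear regularity trades the
  distance to the sampled set for the distance to \<open>C\<close>, which turns the factor
  \<open>3 / 4\<close> into \<open>3 / (4 * \<kappa>)\<close>.\<close>

lemma expected_descent:
  defines "a \<equiv> \<lambda>k. (\<integral>\<omega>. (norm (iter k \<omega> - xstar))\<^sup>2 \<partial>P)"
  shows "a (Suc k) \<le> a k + 2 * \<mu> * (\<integral>\<omega>. F xstar - F (iter k \<omega>) \<partial>P) + \<mu>\<^sup>2 * B"
    and "a (Suc k) \<le> a k + 2 * \<mu> * (\<integral>\<omega>. F xstar - F (iter k \<omega>) \<partial>P) + 4 * \<mu>\<^sup>2 * B
      - 3 / (4 * \<kappa>) * (\<integral>\<omega>. (proj_dist C (iter k \<omega>))\<^sup>2 \<partial>P)"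
proof -
  let ?r = "\<lambda>\<omega>. (norm (iter k \<omega> - xstar))\<^sup>2"
  let ?g = "\<lambda>\<omega>. f (S k \<omega>) xstar - f (S k \<omega>) (iter k \<omega>)"
  let ?l = "\<lambda>\<omega>. (L (S k \<omega>))\<^sup>2"
  let ?d = "\<lambda>\<omega>. (proj_dist (X (S k \<omega>)) (iter k \<omega>))\<^sup>2"
  note int = iter_sq_integrable[of k] gap_sample_integrable[of k] L_sample_sq(1)[of k]
    proj_dist_sample_integrable[of k]
  have ptw: "(norm (iter (Suc k) \<omega> - xstar))\<^sup>2 \<le> ?r \<omega> + 2 * \<mu> * ?g \<omega> + \<mu>\<^sup>2 * ?l \<omega>"
    "(norm (iter (Suc k) \<omega> - xstar))\<^sup>2
      \<le> ?r \<omega> + 2 * \<mu> * ?g \<omega> + 4 * \<mu>\<^sup>2 * ?l \<omega> - 3 / 4 * ?d \<omega>"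
    if "\<omega> \<in> space P" for \<omega>
  proof -
    have s: "S k \<omega> \<in> space M" using that by (rule S_space)
    note descent = prox_closest_point_descent[OF f_lipschitz[OF s] f_convex[OF s] mu_pos
        X_closed[OF s] X_convex[OF s] xstar_in[OF s], of "iter k \<omega>"]
    show "(norm (iter (Suc k) \<omega> - xstar))\<^sup>2 \<le> ?r \<omega> + 2 * \<mu> * ?g \<omega> + \<mu>\<^sup>2 * ?l \<omega>"
      using descent(1) by (simp add: power_mult_distrib)
    show "(norm (iter (Suc k) \<omega> - xstar))\<^sup>2
        \<le> ?r \<omega> + 2 * \<mu> * ?g \<omega> + 4 * \<mu>\<^sup>2 * ?l \<omega> - 3 / 4 * ?d \<omega>"
      using descent(2) by (simp add: power_mult_distrib)
  qed
  have "a (Suc k) \<le> (\<integral>\<omega>. ?r \<omega> + 2 * \<mu> * ?g \<omega> + \<mu>\<^sup>2 * ?l \<omega> \<partial>P)"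
    unfolding a_def by (intro integral_mono iter_sq_integrable ptw
        Bochner_Integration.integrable_add integrable_mult_right int)
  also have "\<dots> = a k + 2 * \<mu> * (\<integral>\<omega>. ?g \<omega> \<partial>P) + \<mu>\<^sup>2 * (\<integral>\<omega>. ?l \<omega> \<partial>P)"
    unfolding a_def
    by (simp only: Bochner_Integration.integral_add Bochner_Integration.integrable_add
        integrable_mult_right integral_mult_right_zero int)
  finally show "a (Suc k) \<le> a k + 2 * \<mu> * (\<integral>\<omega>. F xstar - F (iter k \<omega>) \<partial>P) + \<mu>\<^sup>2 * B"
    by (simp only: expectation_gap_sample L_sample_sq(2))
  have "a (Suc k) \<le> (\<integral>\<omega>. ?r \<omega> + 2 * \<mu> * ?g \<omega> + 4 * \<mu>\<^sup>2 * ?l \<omega> - 3 / 4 * ?d \<omega> \<partial>P)"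
    unfolding a_def by (intro integral_mono iter_sq_integrable ptw
        Bochner_Integration.integrable_diff
        Bochner_Integration.integrable_add integrable_mult_right int)
  also have "\<dots> = a k + 2 * \<mu> * (\<integral>\<omega>. ?g \<omega> \<partial>P) + 4 * \<mu>\<^sup>2 * (\<integral>\<omega>. ?l \<omega> \<partial>P)
      - 3 / 4 * (\<integral>\<omega>. ?d \<omega> \<partial>P)"
    unfolding a_def
    by (simp only: Bochner_Integration.integral_add Bochner_Integration.integrable_add
        Bochner_Integration.integral_diff
        integrable_mult_right integral_mult_right_zero int)
  finally have "a (Suc k) \<le> a k + 2 * \<mu> * (\<integral>\<omega>. F xstar - F (iter k \<omega>) \<partial>P) + 4 * \<mu>\<^sup>2 * B
      - 3 / 4 * (\<integral>\<omega>. ?d \<omega> \<partial>P)"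
    by (simp only: expectation_gap_sample L_sample_sq(2))
  moreover have "3 / (4 * \<kappa>) * (\<integral>\<omega>. (proj_dist C (iter k \<omega>))\<^sup>2 \<partial>P) \<le> 3 / 4 * (\<integral>\<omega>. ?d \<omega> \<partial>P)"
    using expectation_proj_dist_sample[of k] kappa_pos by (simp add: field_simps)
  ultimately show "a (Suc k) \<le> a k + 2 * \<mu> * (\<integral>\<omega>. F xstar - F (iter k \<omega>) \<partial>P) + 4 * \<mu>\<^sup>2 * B
      - 3 / (4 * \<kappa>) * (\<integral>\<omega>. (proj_dist C (iter k \<omega>))\<^sup>2 \<partial>P)"
    by linarith
qed

text \<open>An infeasible iterate may have a value below the optimal one, but by at most
  \<open>sqrt B * proj_dist C x\<close>; Young's inequality with parameter \<open>c\<close> absorbs this into the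
  distance term.\<close>

lemma expected_gap_young:
  assumes "c > 0"
  shows "2 * \<mu> * (\<integral>\<omega>. F xstar - F (iter k \<omega>) \<partial>P)
    \<le> (\<integral>\<omega>. (proj_dist C (iter k \<omega>))\<^sup>2 \<partial>P) / c + c * \<mu>\<^sup>2 * B"
proof -
  have "(\<integral>\<omega>. 2 * \<mu> * (F xstar - F (iter k \<omega>)) \<partial>P)
      \<le> (\<integral>\<omega>. (proj_dist C (iter k \<omega>))\<^sup>2 / c + c * \<mu>\<^sup>2 * B \<partial>P)"
  proof (rule integral_mono)
    show "integrable P (\<lambda>\<omega>. 2 * \<mu> * (F xstar - F (iter k \<omega>)))"
      using gap_iter_integrable by (rule integrable_mult_right)
    show "integrable P (\<lambda>\<omega>. (proj_dist C (iter k \<omega>))\<^sup>2 / c + c * \<mu>\<^sup>2 * B)"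
      using proj_dist_iter_sq_integrable by simp
    fix \<omega>
    let ?D = "proj_dist C (iter k \<omega>)"
    have "2 * \<mu> * (F xstar - F (iter k \<omega>)) \<le> 2 * \<mu> * (sqrt B * ?D)"
      using mu_pos by (intro mult_left_mono optimality_gap_lower) auto
    moreover have "0 \<le> (?D - c * (\<mu> * sqrt B))\<^sup>2 / c" using assms by simp
    moreover have "(?D - c * (\<mu> * sqrt B))\<^sup>2 / c
        = ?D\<^sup>2 / c + c * \<mu>\<^sup>2 * B - 2 * \<mu> * (sqrt B * ?D)"
      using assms B_pos by (simp add: power2_diff power_mult_distrib field_simps)
        (simp add: power2_eq_square algebra_simps)
    ultimately show "2 * \<mu> * (F xstar - F (iter k \<omega>)) \<le> ?D\<^sup>2 / c + c * \<mu>\<^sup>2 * B" by linarith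
  qed
  also have "\<dots> = (\<integral>\<omega>. (proj_dist C (iter k \<omega>))\<^sup>2 \<partial>P) / c + c * \<mu>\<^sup>2 * B"
    using proj_dist_iter_sq_integrable by (simp add: P.prob_space)
  finally show ?thesis by simp
qed

text \<open>The squared distances to \<open>xstar\<close> telescope, and the last one is dropped as
  nonnegative.\<close>

lemma sum_gap_upper:
  "2 * \<mu> * (\<Sum>k<K. \<integral>\<omega>. F (iter k \<omega>) - F xstar \<partial>P)
    \<le> (norm (x0 - xstar))\<^sup>2 + real K * (\<mu>\<^sup>2 * B)"
proof -
  define a where "a k = (\<integral>\<omega>. (norm (iter k \<omega> - xstar))\<^sup>2 \<partial>P)" for k
  have neg: "(\<integral>\<omega>. F (iter k \<omega>) - F xstar \<partial>P) = - (\<integral>\<omega>. F xstar - F (iter k \<omega>) \<partial>P)" for k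
    by (subst integral_minus[symmetric]) simp
  have "2 * \<mu> * (\<Sum>k<K. \<integral>\<omega>. F (iter k \<omega>) - F xstar \<partial>P)
      = (\<Sum>k<K. 2 * \<mu> * (\<integral>\<omega>. F (iter k \<omega>) - F xstar \<partial>P))"
    by (rule sum_distrib_left)
  also have "\<dots> \<le> (\<Sum>k<K. a k - a (Suc k) + \<mu>\<^sup>2 * B)"
    by (intro sum_mono) (use expected_descent(1) neg in \<open>simp add: a_def algebra_simps\<close>)
  also have "\<dots> = a 0 - a K + real K * (\<mu>\<^sup>2 * B)"
    by (simp add: sum.distrib sum_lessThan_telescope' del: sum_subtractf)
  also have "\<dots> \<le> a 0 + real K * (\<mu>\<^sup>2 * B)" by (simp add: a_def)
  also have "a 0 = (norm (x0 - xstar))\<^sup>2" by (simp add: a_def P.prob_space)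
  finally show ?thesis .
qed

text \<open>The objective gap is eliminated by Young's inequality, at the price of
  \<open>1 / c\<close> in the distance coefficient and of \<open>c\<close> added to the 4 of the
  descent. The result is informative for \<open>c > 4 * \<kappa> / 3\<close>, as holds for the value
  chosen later.\<close>

lemma sum_proj_dist_upper:
  assumes "c > 0"
  shows "(3 / (4 * \<kappa>) - 1 / c) * (\<Sum>k<K. \<integral>\<omega>. (proj_dist C (iter k \<omega>))\<^sup>2 \<partial>P)
    \<le> (norm (x0 - xstar))\<^sup>2 + real K * ((4 + c) * \<mu>\<^sup>2 * B)"
proof -
  define a where "a k = (\<integral>\<omega>. (norm (iter k \<omega> - xstar))\<^sup>2 \<partial>P)" for k
  define e where "e k = (\<integral>\<omega>. (proj_dist C (iter k \<omega>))\<^sup>2 \<partial>P)" for k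
  have step: "(3 / (4 * \<kappa>) - 1 / c) * e k \<le> a k - a (Suc k) + (4 + c) * \<mu>\<^sup>2 * B" for k
    using expected_descent(2)[of k] expected_gap_young[OF assms, of k]
    unfolding a_def[symmetric] e_def[symmetric] by (simp add: algebra_simps)
  have "(3 / (4 * \<kappa>) - 1 / c) * (\<Sum>k<K. e k) = (\<Sum>k<K. (3 / (4 * \<kappa>) - 1 / c) * e k)"
    by (rule sum_distrib_left)
  also have "\<dots> \<le> (\<Sum>k<K. a k - a (Suc k) + (4 + c) * \<mu>\<^sup>2 * B)" by (intro sum_mono step)
  also have "\<dots> = a 0 - a K + real K * ((4 + c) * \<mu>\<^sup>2 * B)"
    by (simp add: sum.distrib sum_lessThan_telescope' del: sum_subtractf)
  also have "\<dots> \<le> a 0 + real K * ((4 + c) * \<mu>\<^sup>2 * B)" by (simp add: a_def)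
  also have "a 0 = (norm (x0 - xstar))\<^sup>2" by (simp add: a_def P.prob_space)
  finally show ?thesis by (simp add: e_def)
qed

section \<open>From the iterates to their average\<close>

abbreviation average :: "nat \<Rightarrow> 'w \<Rightarrow> 'a"
  where "average K \<omega> \<equiv> spp_average \<mu> f X x0 (\<lambda>i. S i \<omega>) K"

lemma average_measurable[measurable]: "average K \<in> borel_measurable P"
  unfolding spp_average_def by measurable

lemma proj_dist_average_sq_le:
  assumes "K > 0"
  shows "(proj_dist C (average K \<omega>))\<^sup>2 \<le> (\<Sum>k<K. (proj_dist C (iter k \<omega>))\<^sup>2) / real K"
proof -
  have "(proj_dist C (average K \<omega>))\<^sup>2 \<le> ((\<Sum>k<K. proj_dist C (iter k \<omega>)) / real K)\<^sup>2"
    unfolding spp_average_def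
    by (intro power_mono proj_dist_average_le proj_dist_nonneg C_closed C_convex C_nonempty assms)
  also have "\<dots> \<le> (\<Sum>k<K. (proj_dist C (iter k \<omega>))\<^sup>2) / real K"
    by (rule power2_average_le[OF assms])
  finally show ?thesis .
qed

lemma average_norm_sq_le:
  assumes "K > 0"
  shows "(norm (average K \<omega> - xstar))\<^sup>2 \<le> (\<Sum>k<K. (norm (iter k \<omega> - xstar))\<^sup>2) / real K"
proof -
  have "average K \<omega> - xstar = (1 / real K) *\<^sub>R (\<Sum>k<K. iter k \<omega> - xstar)"
    using assms by (simp add: spp_average_def sum_subtractf scaleR_diff_right sum_constant_scaleR)
  then have "norm (average K \<omega> - xstar) \<le> (\<Sum>k<K. norm (iter k \<omega> - xstar)) / real K"
    using assms by (simp add: divide_right_mono norm_sum)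
  then have "(norm (average K \<omega> - xstar))\<^sup>2 \<le> ((\<Sum>k<K. norm (iter k \<omega> - xstar)) / real K)\<^sup>2"
    by (intro power_mono) auto
  also have "\<dots> \<le> (\<Sum>k<K. (norm (iter k \<omega> - xstar))\<^sup>2) / real K"
    by (rule power2_average_le[OF assms])
  finally show ?thesis .
qed

lemma average_sq_integrable:
  assumes "K > 0"
  shows "integrable P (\<lambda>\<omega>. (norm (average K \<omega> - xstar))\<^sup>2)"
proof (rule Bochner_Integration.integrable_bound)
  show "integrable P (\<lambda>\<omega>. (\<Sum>k<K. (norm (iter k \<omega> - xstar))\<^sup>2) / real K)"
    using iter_sq_integrable by auto
  show "AE \<omega> in P. norm ((norm (average K \<omega> - xstar))\<^sup>2)
      \<le> norm ((\<Sum>k<K. (norm (iter k \<omega> - xstar))\<^sup>2) / real K)"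
    using average_norm_sq_le[OF assms] by (auto intro!: AE_I2 simp: abs_of_nonneg sum_nonneg)
qed measurable

lemma proj_dist_average_sq_integrable:
  "K > 0 \<Longrightarrow> integrable P (\<lambda>\<omega>. (proj_dist C (average K \<omega>))\<^sup>2)"
  by (intro proj_dist_C_sq_integrable average_measurable average_sq_integrable)

text \<open>\<open>F\<close> grows at most linearly, and the average has a finite second
  moment.\<close>

lemma F_average_integrable:
  assumes "K > 0"
  shows "integrable P (\<lambda>\<omega>. F (average K \<omega>))"
proof -
  have "integrable P (\<lambda>\<omega>. norm (average K \<omega> - xstar))"
    by (rule P.square_integrable_imp_integrable[OF _ average_sq_integrable[OF assms]]) measurable
  then have "integrable P (\<lambda>\<omega>. sqrt B * norm (average K \<omega> - xstar))" by simp
  then have "integrable P (\<lambda>\<omega>. F (average K \<omega>) - F xstar)"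
    by (rule Bochner_Integration.integrable_bound)
      (use F_lipschitz in \<open>auto intro!: AE_I2 order_trans[OF _ abs_ge_self]\<close>)
  from Bochner_Integration.integrable_add[OF this P.integrable_const[of "F xstar"]]
  show ?thesis by simp
qed

lemma expectation_proj_dist_average_le:
  assumes "K > 0"
  shows "(\<integral>\<omega>. (proj_dist C (average K \<omega>))\<^sup>2 \<partial>P)
    \<le> (\<Sum>k<K. \<integral>\<omega>. (proj_dist C (iter k \<omega>))\<^sup>2 \<partial>P) / real K"
proof -
  have "(\<integral>\<omega>. (proj_dist C (average K \<omega>))\<^sup>2 \<partial>P)
      \<le> (\<integral>\<omega>. (\<Sum>k<K. (proj_dist C (iter k \<omega>))\<^sup>2) / real K \<partial>P)"
    using proj_dist_iter_sq_integrable
    by (intro integral_mono proj_dist_average_sq_integrable proj_dist_average_sq_le assms) auto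
  then show ?thesis using proj_dist_iter_sq_integrable by simp
qed

lemma expectation_F_average_le:
  assumes "K > 0"
  shows "(\<integral>\<omega>. F (average K \<omega>) \<partial>P) - F xstar
    \<le> (\<Sum>k<K. \<integral>\<omega>. F (iter k \<omega>) - F xstar \<partial>P) / real K"
proof -
  have int: "integrable P (\<lambda>\<omega>. F (iter k \<omega>) - F xstar)" for k
    using Bochner_Integration.integrable_minus[OF gap_iter_integrable[of k]] by simp
  have "(\<integral>\<omega>. F (average K \<omega>) \<partial>P) - F xstar = (\<integral>\<omega>. F (average K \<omega>) - F xstar \<partial>P)"
    using F_average_integrable[OF assms] by (simp add: P.prob_space)
  also have "\<dots> \<le> (\<integral>\<omega>. (\<Sum>k<K. F (iter k \<omega>) - F xstar) / real K \<partial>P)"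
  proof (rule integral_mono)
    fix \<omega>
    have "F (average K \<omega>) \<le> (\<Sum>k<K. F (iter k \<omega>)) / real K"
      unfolding spp_average_def by (rule convex_on_average_le[OF F_convex assms])
    then show "F (average K \<omega>) - F xstar \<le> (\<Sum>k<K. F (iter k \<omega>) - F xstar) / real K"
      using assms by (simp add: sum_subtractf diff_divide_distrib)
  qed (use int F_average_integrable[OF assms] in auto)
  also have "\<dots> = (\<Sum>k<K. \<integral>\<omega>. F (iter k \<omega>) - F xstar \<partial>P) / real K"
    using int by simp
  finally show ?thesis .
qed

text \<open>The gap bound is linear in the distance, while the estimate at hand is for its square.
  The arithmetic-geometric mean inequality links them; its weight makes both terms
  \<open>\<epsilon> / 2\<close> when the expected square is
  \<open>\<epsilon>\<^sup>2 / B\<close>.\<close>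

lemma expectation_F_average_ge:
  assumes "K > 0" "\<epsilon> > 0"
  shows "F xstar - (\<integral>\<omega>. F (average K \<omega>) \<partial>P)
    \<le> B / (2 * \<epsilon>) * (\<integral>\<omega>. (proj_dist C (average K \<omega>))\<^sup>2 \<partial>P) + \<epsilon> / 2"
proof -
  note int = proj_dist_average_sq_integrable[OF assms(1)] F_average_integrable[OF assms(1)]
  have "F xstar - (\<integral>\<omega>. F (average K \<omega>) \<partial>P) = (\<integral>\<omega>. F xstar - F (average K \<omega>) \<partial>P)"
    using int by (simp add: P.prob_space)
  also have "\<dots> \<le> (\<integral>\<omega>. B / (2 * \<epsilon>) * (proj_dist C (average K \<omega>))\<^sup>2 + \<epsilon> / 2 \<partial>P)"
  proof (rule integral_mono)
    fix \<omega>
    let ?D = "proj_dist C (average K \<omega>)"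
    have "0 \<le> (sqrt B * ?D - \<epsilon>)\<^sup>2 / (2 * \<epsilon>)" using assms by simp
    also have "\<dots> = B / (2 * \<epsilon>) * ?D\<^sup>2 + \<epsilon> / 2 - sqrt B * ?D"
      using assms B_pos by (simp add: power2_diff power_mult_distrib field_simps)
        (simp add: power2_eq_square)
    finally show "F xstar - F (average K \<omega>) \<le> B / (2 * \<epsilon>) * ?D\<^sup>2 + \<epsilon> / 2"
      using optimality_gap_lower[of "average K \<omega>"] by linarith
  qed (use int in auto)
  also have "\<dots> = B / (2 * \<epsilon>) * (\<integral>\<omega>. (proj_dist C (average K \<omega>))\<^sup>2 \<partial>P) + \<epsilon> / 2"
    using int by (simp add: P.prob_space)
  finally show ?thesis .
qed

text \<open>Once \<open>\<kappa> \<ge> 1\<close>, the constant \<open>3\<kappa> + sqrt (2\<kappa>)\<close> satisfies \<open>c\<^sup>2 (3/(4\<kappa>) - 1/c) \<ge> 5 + c\<close>, which is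
  what the averaged recursion for the distances needs.\<close>

lemma expectation_proj_dist_average_bound:
  fixes K
  defines "c \<equiv> 3 * \<kappa> + sqrt (2 * \<kappa>)"
  assumes K: "K > 0" and R: "(norm (x0 - xstar))\<^sup>2 \<le> real K * (\<mu>\<^sup>2 * B)"
  shows "(\<integral>\<omega>. (proj_dist C (average K \<omega>))\<^sup>2 \<partial>P) \<le> c\<^sup>2 * (\<mu>\<^sup>2 * B)"
proof (cases "C = UNIV")
  \<comment> \<open>No lower bound on \<kappa> is at hand in this case, but all distances to
    \<open>C\<close> vanish.\<close>
  case True
  then have "proj_dist C x = 0" for x by (simp add: proj_dist_def closest_point_self)
  then show ?thesis using B_pos by simp
next
  case False
  then have k: "\<kappa> \<ge> 1" by (rule kappa_ge_1)
  define r where "r = sqrt (2 * \<kappa>)"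
  have r2: "r\<^sup>2 = 2 * \<kappa>" using k by (simp add: r_def)
  \<comment> \<open>A rational lower bound for the square root of 2. The coefficient inequality
    below reduces to \<open>3 / 4 * \<kappa> + 5 / 2 * r \<ge> 7 / 2\<close>.\<close>
  have r: "r \<ge> 7 / 5" unfolding r_def using k by (intro real_le_rsqrt) (simp add: power2_eq_square)
  have c: "c = 3 * \<kappa> + r" "c > 0" using k r by (auto simp: c_def r_def)
  define E where "E = (\<Sum>k<K. \<integral>\<omega>. (proj_dist C (iter k \<omega>))\<^sup>2 \<partial>P)"
  have "c\<^sup>2 = 9 * \<kappa>\<^sup>2 + 6 * \<kappa> * r + 2 * \<kappa>"
    unfolding c(1) power2_sum power_mult_distrib r2 by simp
  then have "3 / (4 * \<kappa>) * c\<^sup>2 = 27 / 4 * \<kappa> + 9 / 2 * r + 3 / 2"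
    using k by (simp add: field_simps power2_eq_square)
  moreover have "c\<^sup>2 * (1 / c) = c" using c by (simp add: power2_eq_square)
  ultimately have "c\<^sup>2 * (3 / (4 * \<kappa>) - 1 / c) = 27 / 4 * \<kappa> + 9 / 2 * r + 3 / 2 - c"
    by (simp add: right_diff_distrib mult.commute)
  also have "\<dots> \<ge> 5 + c" using k r c(1) by linarith
  finally have key: "5 + c \<le> c\<^sup>2 * (3 / (4 * \<kappa>) - 1 / c)" .
  have E0: "E \<ge> 0" unfolding E_def by (intro sum_nonneg) simp
  have "(5 + c) * E \<le> c\<^sup>2 * ((3 / (4 * \<kappa>) - 1 / c) * E)"
    using mult_right_mono[OF key E0] by (simp add: mult.assoc)
  also have "\<dots> \<le> c\<^sup>2 * ((norm (x0 - xstar))\<^sup>2 + real K * ((4 + c) * \<mu>\<^sup>2 * B))"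
    unfolding E_def by (intro mult_left_mono sum_proj_dist_upper c(2)) simp
  \<comment> \<open>By \<open>R\<close> the initial error counts as one more
    \<open>\<mu>\<^sup>2 * B\<close> per iteration, so \<open>4 + c\<close> becomes
    \<open>5 + c\<close> and cancels against the left side.\<close>
  also have "\<dots> \<le> c\<^sup>2 * (real K * (\<mu>\<^sup>2 * B) + real K * ((4 + c) * \<mu>\<^sup>2 * B))"
    using R by (intro mult_left_mono add_right_mono) auto
  also have "\<dots> = (5 + c) * (c\<^sup>2 * (\<mu>\<^sup>2 * B) * real K)" by (simp add: algebra_simps)
  finally have "E \<le> c\<^sup>2 * (\<mu>\<^sup>2 * B) * real K" using c(2) by simp
  then have "E / real K \<le> c\<^sup>2 * (\<mu>\<^sup>2 * B)" using K by (simp add: pos_divide_le_eq)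
  then show ?thesis using expectation_proj_dist_average_le[OF K] unfolding E_def by linarith
qed

text \<open>Under \<open>R\<close> both terms of \<open>sum_gap_upper\<close> are at most
  \<open>real K * (\<mu>\<^sup>2 * B)\<close>, which the factor 2 on the left absorbs.\<close>

lemma expectation_F_average_upper:
  assumes K: "K > 0" and R: "(norm (x0 - xstar))\<^sup>2 \<le> real K * (\<mu>\<^sup>2 * B)"
  shows "(\<integral>\<omega>. F (average K \<omega>) \<partial>P) - F xstar \<le> \<mu> * B"
proof -
  define G where "G = (\<Sum>k<K. \<integral>\<omega>. F (iter k \<omega>) - F xstar \<partial>P)"
  have "2 * \<mu> * G \<le> 2 * \<mu> * (\<mu> * B * real K)"
    using sum_gap_upper[of K] R by (simp add: G_def power2_eq_square mult_ac)
  then have "G / real K \<le> \<mu> * B" using mu_pos K by (simp add: pos_divide_le_eq)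
  then show ?thesis using expectation_F_average_le[OF K] by (simp add: G_def)
qed

end

text \<open>Integrability is part of the conclusion, so that the expectations are not the default
  value 0 of a divergent integral. If all of space is feasible, linear regularity holds for every
  positive \<kappa>; \<open>unconstrained_kappa\<close> then supplies the bound needed to get
  \<open>\<mu> * B \<le> \<epsilon>\<close>.\<close>

theorem corollary8:
  fixes M :: "'s measure"
    and P :: "'w measure"
    and S :: "nat \<Rightarrow> 'w \<Rightarrow> 's"
    and f :: "'s \<Rightarrow> real ^ 'n \<Rightarrow> real"
    and X :: "'s \<Rightarrow> (real ^ 'n) set"
    and L :: "'s \<Rightarrow> real"
    and x0 xstar :: "real ^ 'n"
    and \<kappa> \<epsilon> \<mu> B :: real
    and K :: nat
  assumes prob_M: "prob_space M"
    and prob_P: "prob_space P"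
    and indep_S: "prob_space.indep_vars P (\<lambda>_. M) S UNIV"
    and distr_S: "\<And>k. distr P M (S k) = M"
    and f_integrable: "\<And>x. integrable M (\<lambda>s. f s x)"
    and f_convex: "\<And>s. s \<in> space M \<Longrightarrow> convex_on UNIV (f s)"
    and f_closed: "\<And>s. s \<in> space M \<Longrightarrow> closed (epigraph UNIV (f s))"
    and L_pos: "\<And>s. s \<in> space M \<Longrightarrow> L s > 0"
    and f_lipschitz: "\<And>s. s \<in> space M \<Longrightarrow> (L s)-lipschitz_on UNIV (f s)"
    and L_sq_integrable: "integrable M (\<lambda>s. (L s)\<^sup>2)"
    and X_nonempty: "\<And>s. s \<in> space M \<Longrightarrow> X s \<noteq> {}"
    and X_closed: "\<And>s. s \<in> space M \<Longrightarrow> closed (X s)"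
    and X_convex: "\<And>s. s \<in> space M \<Longrightarrow> convex (X s)"
    and X_measurable: "\<And>x. (\<lambda>s. proj_dist (X s) x) \<in> borel_measurable M"
    and xstar_optimal: "optimal_solution M f X xstar"
    and kappa_pos: "\<kappa> > 0"
    and linear_regularity:
      "\<And>x. (proj_dist (feasible M X) x)\<^sup>2 \<le> \<kappa> * (\<integral>s. (proj_dist (X s) x)\<^sup>2 \<partial>M)"
    and unconstrained_kappa: "feasible M X = UNIV \<Longrightarrow> 3 * \<kappa> + sqrt (2 * \<kappa>) \<ge> 1"
    and B_eq: "B = (\<integral>s. (L s)\<^sup>2 \<partial>M)"
    and x0_far: "norm (x0 - xstar) \<ge> 1"
    and B_ge_2: "B \<ge> 2"
    and eps_pos: "\<epsilon> > 0"
    and K_ge: "real K \<ge> B * (norm (x0 - xstar))\<^sup>2 / \<epsilon>\<^sup>2 * max 1 ((3 * \<kappa> + sqrt (2 * \<kappa>))\<^sup>2)"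
    and mu_eq: "\<mu> = \<epsilon> / (B * (3 * \<kappa> + sqrt (2 * \<kappa>)))"
  shows "integrable P (\<lambda>\<omega>. objective M f (spp_average \<mu> f X x0 (\<lambda>k. S k \<omega>) K))
    \<and> integrable P
           (\<lambda>\<omega>. (proj_dist (feasible M X) (spp_average \<mu> f X x0 (\<lambda>k. S k \<omega>) K))\<^sup>2)
    \<and> \<bar>(\<integral>\<omega>. objective M f (spp_average \<mu> f X x0 (\<lambda>k. S k \<omega>) K) \<partial>P)
            - opt_value M f X\<bar> \<le> \<epsilon>
    \<and> sqrt (\<integral>\<omega>. (proj_dist (feasible M X)
            (spp_average \<mu> f X x0 (\<lambda>k. S k \<omega>) K))\<^sup>2 \<partial>P) \<le> \<epsilon>"
proof -
  define c where "c = 3 * \<kappa> + sqrt (2 * \<kappa>)"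
  have B: "B > 0" using B_ge_2 by simp
  have c_pos: "c > 0" using kappa_pos by (simp add: c_def add_pos_nonneg)
  have mu: "\<mu> = \<epsilon> / (B * c)" by (simp add: mu_eq c_def)
  have mu_pos: "\<mu> > 0" using eps_pos B c_pos by (simp add: mu)
  interpret M: prob_space M by (rule prob_M)
  interpret P: prob_space P by (rule prob_P)
  interpret spp_setting M P S f X L x0 xstar \<kappa> \<mu> B
    using assms B mu_pos by unfold_locales auto
  have c_ge_1: "c \<ge> 1"
  proof (cases "C = UNIV")
    case False
    then have "\<kappa> \<ge> 1" by (rule kappa_ge_1)
    then show ?thesis by (simp add: c_def add_increasing2)
  qed (use unconstrained_kappa in \<open>simp add: c_def\<close>)
  \<comment> \<open>The average divides by \<open>K\<close>, so \<open>K = 0\<close> must be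
    excluded; the separation of \<open>x0\<close> from \<open>xstar\<close> does this.\<close>
  have "0 < B * (norm (x0 - xstar))\<^sup>2 / \<epsilon>\<^sup>2 * max 1 (c\<^sup>2)"
    using B x0_far eps_pos by (intro mult_pos_pos divide_pos_pos) auto
  also have "\<dots> \<le> real K" using K_ge by (simp add: c_def)
  finally have K: "K > 0" by simp
  \<comment> \<open>The stepsize gives
    \<open>\<mu>\<^sup>2 * B = \<epsilon>\<^sup>2 / (B * c\<^sup>2)\<close>, so the part of the
    bound on \<open>K\<close> with \<open>c\<^sup>2\<close> is precisely the condition
    \<open>R\<close>.\<close>
  have "B * (norm (x0 - xstar))\<^sup>2 / \<epsilon>\<^sup>2 * c\<^sup>2 \<le> B * (norm (x0 - xstar))\<^sup>2 / \<epsilon>\<^sup>2 * max 1 (c\<^sup>2)"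
    using B by (intro mult_left_mono) auto
  also have "\<dots> \<le> real K" using K_ge by (simp add: c_def)
  finally have "(norm (x0 - xstar))\<^sup>2 \<le> real K * (\<mu>\<^sup>2 * B)"
    using B c_pos eps_pos unfolding mu by (simp add: field_simps power2_eq_square)
  note R = K this
  have "\<mu> * B = \<epsilon> / c" using B by (simp add: mu)
  also have "\<dots> \<le> \<epsilon>" using c_ge_1 eps_pos by (simp add: pos_divide_le_eq)
  finally have upper: "(\<integral>\<omega>. F (average K \<omega>) \<partial>P) - F xstar \<le> \<epsilon>"
    using expectation_F_average_upper[OF R] by linarith
  \<comment> \<open>The constant \<open>c\<close> in the denominator of the stepsize is chosen to
    cancel the factor in the distance bound.\<close>
  have "c\<^sup>2 * (\<mu>\<^sup>2 * B) = \<epsilon>\<^sup>2 / B"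
    using B c_pos by (simp add: mu power2_eq_square field_simps)
  then have dist: "(\<integral>\<omega>. (proj_dist C (average K \<omega>))\<^sup>2 \<partial>P) \<le> \<epsilon>\<^sup>2 / B"
    using expectation_proj_dist_average_bound[OF R] by (simp add: c_def)
  then have "B / (2 * \<epsilon>) * (\<integral>\<omega>. (proj_dist C (average K \<omega>))\<^sup>2 \<partial>P) \<le> B / (2 * \<epsilon>) * (\<epsilon>\<^sup>2 / B)"
    using B eps_pos by (intro mult_left_mono) auto
  also have "\<dots> = \<epsilon> / 2" using B eps_pos by (simp add: power2_eq_square)
  finally have lower: "F xstar - (\<integral>\<omega>. F (average K \<omega>) \<partial>P) \<le> \<epsilon>"
    using expectation_F_average_ge[OF K eps_pos] by linarith
  have "\<epsilon>\<^sup>2 / B \<le> \<epsilon>\<^sup>2" using B_ge_2 by (simp add: divide_le_eq mult_le_cancel_left1)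
  then have "sqrt (\<integral>\<omega>. (proj_dist C (average K \<omega>))\<^sup>2 \<partial>P) \<le> \<epsilon>"
    using dist eps_pos by (intro real_le_lsqrt) auto
  moreover have "\<bar>(\<integral>\<omega>. F (average K \<omega>) \<partial>P) - opt_value M f X\<bar> \<le> \<epsilon>"
    using upper lower by (simp add: opt_value_eq abs_le_iff)
  ultimately show ?thesis
    using F_average_integrable[OF K] proj_dist_average_sq_integrable[OF K] by blast
qed

end
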